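(* Let $G$ be a compact connected Hausdorff abelian topological group and let $k\in\mathbb N$. All finite-sheeted covering mappings $p:X\to G$ of degree $k$ (with $X$ an arbitrary Hausdorff topological space, not necessarily connected) are trivial if and only if $G$ admits a $k!$-mean.
   Context: $\mathbb N=\{1,2,\dots\}$. A continuous surjection $p:X\to Y$ between topological spaces is a $k$-fold covering mapping (a finite-sheeted covering mapping of degree $k$) if every $y\in Y$ has an open neighborhood $W$ such that $p^{-1}(W)$ is a disjoint union of $k$ open sets $V_1,\dots,V_k$ of $X$, each mapped homeomorphically onto $W$ by $p$. A $k$-fold covering mapping $p:X\to Y$ is trivial if there is a homeomorphism $\rho:Y\times\{1,\dots,k\}\to X$, where $\{1,\dots,k\}$ is discrete, such that $p(\rho(y,n))=y$ for all $(y,n)$. For $m\in\mathbb N$, an $m$-mean on $G$ is a continuous mapping $\mu:G^m\to G$ such that $\mu(g_1,\dots,g_m)=\mu(g_{\pi(1)},\dots,g_{\pi(m)})$ for every permutation $\pi$ of $\{1,\dots,m\}$ and all $g_1,\dots,g_m\in G$, and $\mu(g,g,\dots,g)=g$ for all $g\in G$. *)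

theory Defs
  imports "HOL-Analysis.Analysis" "HOL-Combinatorics.Permutations"
begin

definition fold_covering_map :: "nat \<Rightarrow> 'b topology \<Rightarrow> 'a topology \<Rightarrow> ('b \<Rightarrow> 'a) \<Rightarrow> bool" where
  "fold_covering_map k X Y p \<longleftrightarrow>
     continuous_map X Y p \<and> p ` topspace X = topspace Y \<and>
     (\<forall>y \<in> topspace Y. \<exists>W. openin Y W \<and> y \<in> W \<and>
        (\<exists>V :: nat \<Rightarrow> 'b set.
           {x \<in> topspace X. p x \<in> W} = (\<Union>i\<in>{1..k}. V i) \<and>
           disjoint_family_on V {1..k} \<and>
           (\<forall>i\<in>{1..k}. openin X (V i) \<and>
              homeomorphic_map (subtopology X (V i)) (subtopology Y W) p)))"

definition trivial_fold_covering :: "nat \<Rightarrow> 'b topology \<Rightarrow> 'a topology \<Rightarrow> ('b \<Rightarrow> 'a) \<Rightarrow> bool" where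
  "trivial_fold_covering k X Y p \<longleftrightarrow>
     (\<exists>\<rho> :: 'a \<times> nat \<Rightarrow> 'b.
        homeomorphic_map (prod_topology Y (discrete_topology {1..k})) X \<rho> \<and>
        (\<forall>y \<in> topspace Y. \<forall>n \<in> {1..k}. p (\<rho> (y, n)) = y))"

text \<open>
  The power of \<open>Y\<close> with exponent \<open>m\<close> is the product topology over the index set \<open>{1..m}\<close>; its
  points are the functions on \<open>nat\<close> that are \<open>undefined\<close> outside \<open>{1..m}\<close>. A permutation of
  \<open>{1..m}\<close> fixes every other index, so composing with it preserves this set of points.
\<close>

definition is_mean :: "nat \<Rightarrow> 'a topology \<Rightarrow> ((nat \<Rightarrow> 'a) \<Rightarrow> 'a) \<Rightarrow> bool" where
  "is_mean m Y \<mu> \<longleftrightarrow>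
     continuous_map (product_topology (\<lambda>_. Y) {1..m}) Y \<mu> \<and>
     (\<forall>\<pi> g. \<pi> permutes {1..m} \<longrightarrow> g \<in> {1..m} \<rightarrow>\<^sub>E topspace Y \<longrightarrow> \<mu> (g \<circ> \<pi>) = \<mu> g) \<and>
     (\<forall>y \<in> topspace Y. \<mu> (\<lambda>i\<in>{1..m}. y) = y)"

definition admits_mean :: "nat \<Rightarrow> 'a topology \<Rightarrow> bool" where
  "admits_mean m Y \<longleftrightarrow> (\<exists>\<mu>. is_mean m Y \<mu>)"

text \<open>
  A formula cannot quantify over all types, so ``every covering of \<open>Y\<close> by a Hausdorff space'' is
  relative to the type \<open>'b\<close> of the points of the covering space, recorded by the \<open>itself\<close>
  argument. All fibres of a \<open>k\<close>-fold covering have \<open>k\<close> points, so its total space is equipotent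
  to \<open>topspace Y \<times> {1..k}\<close>. Hence, up to homeomorphism over \<open>Y\<close>, the type \<open>'a \<times> nat\<close> already
  carries every \<open>k\<close>-fold covering of \<open>Y :: 'a topology\<close>.
\<close>

definition all_fold_coverings_trivial :: "'b itself \<Rightarrow> nat \<Rightarrow> 'a topology \<Rightarrow> bool" where
  "all_fold_coverings_trivial (_ :: 'b itself) k Y \<longleftrightarrow>
     (\<forall>(X :: 'b topology) p. Hausdorff_space X \<longrightarrow> fold_covering_map k X Y p \<longrightarrow>
        trivial_fold_covering k X Y p)"

end

theory Submission
  imports Defs "HOL-Computational_Algebra.Group_Closure" "HOL-Number_Theory.Cong"
begin

text \<open>
  \<^emph>\<open>From a mean to trivial coverings.\<close> The space \<open>G\<close> need not be locally connected, so loops and path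
  lifting are replaced by chains of small steps. By compactness a finite-sheeted covering \<open>p : X \<rightarrow> G\<close>
  has a uniform transport: a point over \<open>x\<close> can be moved to a definite nearby point over every \<open>y\<close>
  with \<open>y - x\<close> in a fixed neighbourhood \<open>N\<close> of \<open>0\<close>, consistently on triangles with sides in \<open>N\<close>
  (\<open>covering_has_transport\<close>). Connectedness joins \<open>0\<close> to every point by a chain, and the covering
  is trivial as soon as every closed chain at \<open>0\<close> acts trivially on the fibre
  (\<open>loops_trivial_imp_trivial\<close>). For the mean \<open>\<mu>\<close> with \<open>m = k!\<close> arguments, a closed chain
  \<open>x\<^sub>0, \<dots>, x\<^sub>r\<close> at \<open>0\<close> gives the closed chains \<open>\<mu>(x\<^sub>i, \<dots>, x\<^sub>i, 0, \<dots>, 0)\<close> with \<open>s\<close> entries \<open>x\<^sub>i\<close>.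
  Sweeping the grid \<open>\<mu>(x\<^sub>i, \<dots>, x\<^sub>i, x\<^sub>j, 0, \<dots>, 0)\<close> from its diagonal to two of its sides
  (\<open>carry_diagonal\<close>) shows that the monodromy for \<open>s\<close> is the monodromy for \<open>s - 1\<close> followed by
  that of \<open>\<mu>(0, \<dots>, x\<^sub>j, \<dots>, 0)\<close>, which by symmetry does not depend on the position of \<open>x\<^sub>j\<close>. For
  \<open>s = m\<close> the chain is the original one, so its monodromy is an \<open>m\<close>-th power of a permutation of \<open>k\<close>
  points, hence the identity because \<open>m = k!\<close>.
  
  \<^emph>\<open>From trivial coverings to a mean.\<close> If multiplication by \<open>k!\<close> is bijective on \<open>G\<close>, then it is a
  homeomorphism and dividing the sum of the arguments by \<open>k!\<close> is a mean. A compact connected group is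
  divisible (\<open>compact_connected_divisible\<close>), so only torsion of prime order \<open>q \<le> k\<close> has to be excluded.
  Let \<open>K\<close> be the group of elements killed by \<open>q\<close> and let \<open>y \<in> K\<close> be nonzero. There is a relatively
  open subgroup \<open>M\<close> of index \<open>q\<close> in \<open>K\<close> that does not contain \<open>y\<close>, and \<open>G/M \<rightarrow> G/K \<cong> G\<close> is a
  connected \<open>q\<close>-fold covering; with \<open>k - q\<close> further copies of \<open>G\<close> it becomes a nontrivial \<open>k\<close>-fold
  covering (\<open>coverings_trivial_imp_torsion_free\<close>).
  
  Divisibility and the subgroup \<open>M\<close> both come from one fact that takes the place of Pontryagin
  duality (\<open>separating_subgroup\<close>): in a closed subgroup \<open>A\<close>, a point outside \<open>nA\<close> is avoided by a
  relatively open subgroup. Here lies the use of compactness: for a small neighbourhood \<open>E\<close> of \<open>0\<close>,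
  finitely many translates of \<open>S = (E + nA) \<inter> A\<close> cover \<open>A\<close>, and Bogolyubov's lemma, proved by Fourier
  analysis on \<open>(\<int>/n)\<^sup>W\<close>, finds a subgroup of finite index inside \<open>S + S - S - S\<close>. The bound
  on its index is uniform in the finite set \<open>W \<subseteq> A\<close>, which makes the passage from finitely many
  generators to all of \<open>A\<close> possible.
\<close>

section \<open>Uniform neighbourhoods in compact abelian groups\<close>

definition sym_nbhd :: "'a::topological_ab_group_add set \<Rightarrow> bool" where
  "sym_nbhd N \<longleftrightarrow> open N \<and> 0 \<in> N \<and> (\<forall>x\<in>N. - x \<in> N)"

lemma sym_nbhd_diff_commute: "sym_nbhd N \<Longrightarrow> x - y \<in> N \<longleftrightarrow> y - x \<in> N"
  unfolding sym_nbhd_def by (metis minus_diff_eq)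

lemma open_translate:
  fixes N :: "'a::topological_ab_group_add set"
  assumes "open N" shows "open {x. x - y \<in> N}" "open {x. y + x \<in> N}"
proof -
  have "open ((\<lambda>x. x - y) -` N)" "open ((\<lambda>x. y + x) -` N)"
    by (rule open_vimage[OF assms]; intro continuous_intros)+
  then show "open {x. x - y \<in> N}" "open {x. y + x \<in> N}" by (simp_all add: vimage_def)
qed

lemma halve_nbhd:
  fixes U :: "'a::topological_ab_group_add set"
  assumes "open U" "0 \<in> U"
  obtains N where "sym_nbhd N" "\<And>x y. x \<in> N \<Longrightarrow> y \<in> N \<Longrightarrow> x + y \<in> U"
proof -
  have "open ((\<lambda>p. fst p + snd p :: 'a) -` U)"
    by (rule open_vimage[OF assms(1)]) (intro continuous_intros)
  moreover have "(0,0) \<in> (\<lambda>p. fst p + snd p :: 'a) -` U" using assms by simp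
  ultimately obtain A B where AB: "open A" "open B" "(0,0) \<in> A \<times> B"
    "A \<times> B \<subseteq> (\<lambda>p. fst p + snd p) -` U" by (rule open_prod_elim)
  define N where "N = (A \<inter> B) \<inter> uminus -` (A \<inter> B)"
  have "open (uminus -` (A \<inter> B))"
    by (rule open_vimage) (use AB in \<open>auto intro!: continuous_intros\<close>)
  then have "sym_nbhd N" using AB by (auto simp: sym_nbhd_def N_def)
  moreover have "x + y \<in> U" if "x \<in> N" "y \<in> N" for x y
    using that AB(4) unfolding N_def by fastforce
  ultimately show ?thesis using that by blast
qed

lemma sym_nbhd_INT:
  "finite I \<Longrightarrow> (\<And>i. i \<in> I \<Longrightarrow> sym_nbhd (M i)) \<Longrightarrow> sym_nbhd (\<Inter>i\<in>I. M i)"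
  by (auto simp: sym_nbhd_def)

text \<open>
  The Lebesgue number lemma for translates of one neighbourhood. The choice function \<open>c\<close> takes finitely
  many values, so that finitely many conditions can later be imposed on all the sets \<open>O' (c z)\<close> together.
\<close>

lemma Lebesgue_nbhd:
  fixes O' :: "'a::topological_ab_group_add \<Rightarrow> 'a set"
  assumes comp: "compact (UNIV :: 'a set)" and O': "\<And>y. open (O' y)" "\<And>y. y \<in> O' y"
  obtains N c where "sym_nbhd N" "finite (range c)" "\<And>z x. x - z \<in> N \<Longrightarrow> x \<in> O' (c z)"
proof -
  have "\<exists>M. sym_nbhd M \<and> (\<forall>a\<in>M. \<forall>b\<in>M. y + (a + b) \<in> O' y)" for y
  proof -
    obtain M where "sym_nbhd M" "\<And>a b. a \<in> M \<Longrightarrow> b \<in> M \<Longrightarrow> a + b \<in> {x. y + x \<in> O' y}"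
      using halve_nbhd[OF open_translate(2)[OF O'(1), of y y]] O'(2)[of y] by auto
    then show ?thesis by blast
  qed
  then obtain M where M: "\<And>y. sym_nbhd (M y)" "\<And>y a b. a \<in> M y \<Longrightarrow> b \<in> M y \<Longrightarrow> y + (a + b) \<in> O' y"
    by metis
  have "open {z. z - y \<in> M y}" for y
    using open_translate(1) M(1) unfolding sym_nbhd_def by blast
  moreover have "UNIV \<subseteq> (\<Union>y\<in>UNIV. {z. z - y \<in> M y})"
    using M(1) unfolding sym_nbhd_def by auto
  ultimately obtain I where I: "I \<subseteq> UNIV" "finite I" "UNIV \<subseteq> (\<Union>y\<in>I. {z. z - y \<in> M y})"
    by (rule compactE_image[OF comp, of UNIV "\<lambda>y. {z. z - y \<in> M y}"])
  then have "\<exists>y\<in>I. z - y \<in> M y" for z by blast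
  then obtain c where c: "\<And>z. c z \<in> I" "\<And>z. z - c z \<in> M (c z)" by metis
  show ?thesis
  proof (rule that[of "\<Inter>y\<in>I. M y" c])
    show "finite (range c)" using I(2) c(1) by (meson finite_subset image_subsetI)
    show "x \<in> O' (c z)" if "x - z \<in> (\<Inter>y\<in>I. M y)" for x z
    proof -
      have "c z + ((z - c z) + (x - z)) \<in> O' (c z)"
        using M(2) c that by blast
      then show ?thesis by simp
    qed
  qed (use sym_nbhd_INT I M in blast)
qed

text \<open>
  The Heine--Cantor theorem for a map of two variables, with translates of a neighbourhood of \<open>0\<close>
  as the uniformity.
\<close>

lemma uniformly_continuous_pair:
  fixes h :: "'a::topological_ab_group_add \<Rightarrow> 'a \<Rightarrow> 'a"
  assumes comp: "compact (UNIV :: 'a set)"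
    and h: "continuous_on UNIV (\<lambda>z. h (fst z) (snd z))" and N: "sym_nbhd N"
  obtains M where "sym_nbhd M"
    "\<And>x x' y y'. x' - x \<in> M \<Longrightarrow> y' - y \<in> M \<Longrightarrow> h x' y' - h x y \<in> N"
proof -
  obtain N' where N': "sym_nbhd N'" "\<And>x y. x \<in> N' \<Longrightarrow> y \<in> N' \<Longrightarrow> x + y \<in> N"
    using halve_nbhd N unfolding sym_nbhd_def by metis
  have "\<exists>M. sym_nbhd M \<and> (\<forall>a\<in>M. \<forall>b\<in>M. \<forall>a'\<in>M. \<forall>b'\<in>M.
          h (fst z + (a + a')) (snd z + (b + b')) - h (fst z) (snd z) \<in> N')" for z
  proof -
    let ?f = "\<lambda>w. h (fst z + fst w) (snd z + snd w) - h (fst z) (snd z)"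
    have "continuous_on UNIV ((\<lambda>z. h (fst z) (snd z)) \<circ> (\<lambda>w. (fst z + fst w, snd z + snd w)))"
      by (rule continuous_on_compose)
        (auto intro!: continuous_intros intro: continuous_on_subset[OF h])
    then have "continuous_on UNIV ?f"
      unfolding o_def by (auto intro!: continuous_intros)
    then have "open (?f -` N')" using N'(1) by (intro open_vimage) (auto simp: sym_nbhd_def)
    moreover have "(0,0) \<in> ?f -` N'" using N'(1) by (simp add: sym_nbhd_def)
    ultimately obtain A B where AB: "open A" "open B" "(0,0) \<in> A \<times> B" "A \<times> B \<subseteq> ?f -` N'"
      by (rule open_prod_elim)
    obtain M where M: "sym_nbhd M" "\<And>x y. x \<in> M \<Longrightarrow> y \<in> M \<Longrightarrow> x + y \<in> A \<inter> B"
      by (rule halve_nbhd[of "A \<inter> B"]) (use AB in auto)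
    have "?f (a + a', b + b') \<in> N'" if "a \<in> M" "a' \<in> M" "b \<in> M" "b' \<in> M" for a a' b b'
    proof -
      have "(a + a', b + b') \<in> A \<times> B" using M(2) that by blast
      then show ?thesis using AB(4) by blast
    qed
    then show ?thesis using M(1) by auto
  qed
  then obtain M where M: "\<And>z. sym_nbhd (M z)"
    "\<And>z a b a' b'. a \<in> M z \<Longrightarrow> b \<in> M z \<Longrightarrow> a' \<in> M z \<Longrightarrow> b' \<in> M z \<Longrightarrow>
          h (fst z + (a + a')) (snd z + (b + b')) - h (fst z) (snd z) \<in> N'"
    by metis
  define C where "C z = {x. x - fst z \<in> M z} \<times> {y. y - snd z \<in> M z}" for z
  have "compact (UNIV :: ('a \<times> 'a) set)" using compact_Times[OF comp comp] by simp
  moreover have "open (C z)" for z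
    unfolding C_def using open_translate(1) M(1) unfolding sym_nbhd_def by (intro open_Times) blast+
  moreover have "UNIV \<subseteq> (\<Union>z\<in>UNIV. C z)"
  proof
    fix z :: "'a \<times> 'a"
    have "z \<in> C z" using M(1)[of z] unfolding sym_nbhd_def C_def by (cases z) simp
    then show "z \<in> (\<Union>z\<in>UNIV. C z)" by blast
  qed
  ultimately obtain I where I: "I \<subseteq> UNIV" "finite I" "UNIV \<subseteq> (\<Union>z\<in>I. C z)"
    by (rule compactE_image[of UNIV UNIV C])
  show ?thesis
  proof (rule that[of "\<Inter>z\<in>I. M z"])
    show "sym_nbhd (\<Inter>z\<in>I. M z)" using sym_nbhd_INT I M by blast
    fix x x' y y' assume xy: "x' - x \<in> (\<Inter>z\<in>I. M z)" "y' - y \<in> (\<Inter>z\<in>I. M z)"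
    obtain z where z: "z \<in> I" "(x,y) \<in> C z" using I(3) by blast
    then have d: "x - fst z \<in> M z" "y - snd z \<in> M z" by (auto simp: C_def)
    have "0 \<in> M z" using M(1) by (auto simp: sym_nbhd_def)
    have xy': "x' - x \<in> M z" "y' - y \<in> M z" using xy z(1) by auto
    have "h (fst z + (x - fst z + 0)) (snd z + (y - snd z + 0)) - h (fst z) (snd z) \<in> N'"
      "h (fst z + (x - fst z + (x' - x))) (snd z + (y - snd z + (y' - y))) - h (fst z) (snd z) \<in> N'"
      using M(2)[OF d \<open>0 \<in> M z\<close> \<open>0 \<in> M z\<close>] M(2)[OF d xy'] by simp_all
    then have "h x y - h (fst z) (snd z) \<in> N'" "h x' y' - h (fst z) (snd z) \<in> N'" by simp_all
    then have "(h x' y' - h (fst z) (snd z)) + (h (fst z) (snd z) - h x y) \<in> N"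
      using N'(2) sym_nbhd_diff_commute[OF N'(1)] by blast
    then show "h x' y' - h x y \<in> N" by simp
  qed
qed

section \<open>Uniform transport in a finite-sheeted covering\<close>

definition sheet :: "'b topology \<Rightarrow> ('b \<Rightarrow> 'a::topological_space) \<Rightarrow> 'b set \<Rightarrow> 'a set \<Rightarrow> bool" where
  "sheet X p V W \<longleftrightarrow> openin X V \<and> open W \<and>
     homeomorphic_map (subtopology X V) (subtopology euclidean W) p"

lemma sheetD:
  assumes "sheet X p V W"
  shows "V \<subseteq> topspace X" "p ` V = W" "inj_on p V"
    "continuous_map (subtopology euclidean W) X (inv_into V p)"
proof -
  have h: "homeomorphic_map (subtopology X V) (subtopology euclidean W) p"
    and VX: "V \<subseteq> topspace X"
    using assms openin_subset unfolding sheet_def by auto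
  show "V \<subseteq> topspace X" by fact
  show im: "p ` V = W" using homeomorphic_imp_surjective_map[OF h] VX by (simp add: Int_absorb1)
  show inj: "inj_on p V" using homeomorphic_imp_injective_map[OF h] VX by (simp add: Int_absorb1)
  obtain g where g: "homeomorphic_maps (subtopology X V) (subtopology euclidean W) p g"
    using h homeomorphic_map_maps by blast
  then have gc: "continuous_map (subtopology euclidean W) (subtopology X V) g"
    and gp: "\<And>x. x \<in> V \<Longrightarrow> g (p x) = x"
    using VX unfolding homeomorphic_maps_def by auto
  have "continuous_map (subtopology euclidean W) X g"
    using gc continuous_map_in_subtopology by blast
  moreover have "g z = inv_into V p z" if "z \<in> W" for z
    using that gp im inj by auto
  ultimately show "continuous_map (subtopology euclidean W) X (inv_into V p)"
    by (metis (mono_tags, lifting) continuous_map_eq topspace_euclidean_subtopology)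
qed

lemma fold_covering_sheets:
  assumes "fold_covering_map k X euclidean p"
  obtains W V where "open W" "y \<in> W" "{x \<in> topspace X. p x \<in> W} = (\<Union>i\<in>{1..k}. V i)"
    "disjoint_family_on V {1..k}" "\<forall>i\<in>{1..k}. sheet X p (V i) W"
proof -
  have "\<exists>W. openin euclidean W \<and> y \<in> W \<and> (\<exists>V. {x \<in> topspace X. p x \<in> W} = (\<Union>i\<in>{1..k}. V i) \<and>
      disjoint_family_on V {1..k} \<and> (\<forall>i\<in>{1..k}. openin X (V i) \<and>
            homeomorphic_map (subtopology X (V i)) (subtopology euclidean W) p))"
    using assms unfolding fold_covering_map_def topspace_euclidean by blast
  then show ?thesis
    using that unfolding sheet_def open_openin[symmetric] by blast
qed

text \<open>
  The transition between two local trivialisations is locally constant: the overlap of two sheets is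
  open, and \<open>p\<close> maps it onto an open set over which the two local sections coincide.
\<close>

lemma sheets_agree_near:
  assumes s: "sheet X p V W" "sheet X p V' W'" and y: "y \<in> W" "y \<in> W'"
    and eq: "inv_into V p y = inv_into V' p y"
  obtains U where "open U" "y \<in> U" "U \<subseteq> W \<inter> W'"
    "\<And>z. z \<in> U \<Longrightarrow> inv_into V p z = inv_into V' p z"
proof (rule that[of "p ` (V \<inter> V')"])
  note d = sheetD[OF s(1)] and d' = sheetD[OF s(2)]
  have "openin (subtopology X V) (V \<inter> V')"
    using s(2) unfolding sheet_def by (auto simp: openin_subtopology)
  then have "openin (subtopology euclidean W) (p ` (V \<inter> V'))"
    using s(1) homeomorphic_imp_open_map unfolding sheet_def open_map_def by blast
  then show "open (p ` (V \<inter> V'))"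
    using s(1) unfolding sheet_def by (meson open_openin openin_trans_full)
  have "inv_into V p y \<in> V" "inv_into V' p y \<in> V'" "p (inv_into V p y) = y"
    using y d d' by (metis inv_into_into, metis inv_into_into, metis f_inv_into_f)
  then show "y \<in> p ` (V \<inter> V')" using eq by (metis IntI imageI)
  show "p ` (V \<inter> V') \<subseteq> W \<inter> W'" using d d' by auto
  show "inv_into V p z = inv_into V' p z" if "z \<in> p ` (V \<inter> V')" for z
    using that d d' by auto
qed

text \<open>
  A substitute for path lifting that does not refer to paths: \<open>T e y\<close> is the point over \<open>y\<close> next to
  \<open>e\<close>, defined when \<open>y\<close> is close to \<open>p e\<close>. The decisive axiom is \<open>T_trans\<close>: transport around a small
  triangle is trivial, so transport along chains of small steps is invariant under discrete homotopies.
\<close>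

locale transport =
  fixes X :: "'b topology" and p :: "'b \<Rightarrow> 'a::topological_ab_group_add"
    and N :: "'a set" and T :: "'b \<Rightarrow> 'a \<Rightarrow> 'b"
  assumes N: "sym_nbhd N"
    and T_in: "\<And>e y. e \<in> topspace X \<Longrightarrow> y - p e \<in> N \<Longrightarrow> T e y \<in> topspace X"
    and p_T: "\<And>e y. e \<in> topspace X \<Longrightarrow> y - p e \<in> N \<Longrightarrow> p (T e y) = y"
    and T_self: "\<And>e. e \<in> topspace X \<Longrightarrow> T e (p e) = e"
    and T_trans: "\<And>e y z. e \<in> topspace X \<Longrightarrow> y - p e \<in> N \<Longrightarrow> z - y \<in> N \<Longrightarrow> z - p e \<in> N
                    \<Longrightarrow> T (T e y) z = T e z"
    and T_cont: "\<And>e. e \<in> topspace X \<Longrightarrow>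
                    continuous_map (subtopology euclidean {y. y - p e \<in> N}) X (T e)"

text \<open>
  Fix a finite set of evenly covered sets \<open>W i\<close> such that every \<open>z\<close> is uniformly deep inside
  \<open>W (c z)\<close>, and transport \<open>e\<close> inside its sheet over \<open>W (c (p e))\<close>. Two such sets induce the same
  transport only near each common point, because their intersection may be disconnected. Hence the
  step size is shrunk a second time: every \<open>y\<close> gets a neighbourhood \<open>O' y\<close> on which all of the finitely
  many pairs of sheets that agree at \<open>y\<close> agree throughout, and the new step is a Lebesgue number of
  these neighbourhoods.
\<close>

lemma covering_has_transport:
  fixes p :: "'b \<Rightarrow> 'a::topological_ab_group_add"
  assumes comp: "compact (UNIV :: 'a set)" and cov: "fold_covering_map k X euclidean p"
  obtains N T where "transport X p N T"
proof -
  define ev where "ev y W V \<longleftrightarrow> open W \<and> y \<in> W \<and> {x \<in> topspace X. p x \<in> W} = (\<Union>i\<in>{1..k}. V i) \<and>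
           disjoint_family_on V {1..k} \<and> (\<forall>i\<in>{1..k}. sheet X p (V i) W)"
    for y W and V :: "nat \<Rightarrow> 'b set"
  have "\<exists>W V. ev y W V" for y
    using fold_covering_sheets[OF cov, of y] unfolding ev_def by metis
  then obtain W V where WV: "\<And>y. ev y (W y) (V y)" by metis
  then have W: "\<And>y. open (W y)" "\<And>y. y \<in> W y"
    and V: "\<And>y. {x \<in> topspace X. p x \<in> W y} = (\<Union>i\<in>{1..k}. V y i)"
      "\<And>y. disjoint_family_on (V y) {1..k}" "\<And>y i. i \<in> {1..k} \<Longrightarrow> sheet X p (V y i) (W y)"
    unfolding ev_def by blast+
  obtain N1 c where N1: "sym_nbhd N1" and c: "finite (range c)" "\<And>z x. x - z \<in> N1 \<Longrightarrow> x \<in> W (c z)"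
    using Lebesgue_nbhd[OF comp W] by blast
  define g where "g i j = inv_into (V i j) p" for i j
  define same where "same y i j i' j' \<longleftrightarrow> y \<in> W i \<and> y \<in> W i' \<and> g i j y = g i' j' y" for y i j i' j'
  define nbh where "nbh y i j i' j' U \<longleftrightarrow> open U \<and> y \<in> U \<and>
      (same y i j i' j' \<longrightarrow> (\<forall>z\<in>U. same z i j i' j'))" for y i j i' j' U
  define U where "U y i j i' j' = (SOME U. nbh y i j i' j' U)" for y i j i' j'
  have "\<exists>U. nbh y i j i' j' U" if jj: "j \<in> {1..k}" "j' \<in> {1..k}" for y i j i' j'
  proof (cases "same y i j i' j'")
    case True
    then have "y \<in> W i" "y \<in> W i'" "inv_into (V i j) p y = inv_into (V i' j') p y"
      unfolding same_def g_def by auto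
    then obtain U where "open U" "y \<in> U" "U \<subseteq> W i \<inter> W i'"
      "\<And>z. z \<in> U \<Longrightarrow> inv_into (V i j) p z = inv_into (V i' j') p z"
      using sheets_agree_near[OF V(3)[OF jj(1), of i] V(3)[OF jj(2), of i'], of y] by blast
    then show ?thesis unfolding nbh_def same_def g_def by blast
  next
    case False
    then show ?thesis unfolding nbh_def using open_UNIV by blast
  qed
  then have "nbh y i j i' j' (U y i j i' j')" if "j \<in> {1..k}" "j' \<in> {1..k}" for y i j i' j'
    using that unfolding U_def by (metis someI_ex)
  then have U: "open (U y i j i' j') \<and>
      y \<in> U y i j i' j' \<and> (same y i j i' j' \<longrightarrow> (\<forall>z\<in>U y i j i' j'. same z i j i' j'))"
    if "j \<in> {1..k}" "j' \<in> {1..k}" for y i j i' j'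
    using that unfolding nbh_def by blast
  define O' where "O' y = {z. z - y \<in> N1} \<inter>
      (\<Inter>i\<in>range c. \<Inter>i'\<in>range c. \<Inter>j\<in>{1..k}. \<Inter>j'\<in>{1..k}. U y i j i' j')" for y
  have O'1: "open (O' y)" for y
    unfolding O'_def
    by (intro open_Int open_INT ballI c(1) finite_atLeastAtMost)
      (use U N1 in \<open>auto simp: sym_nbhd_def intro: open_translate\<close>)
  have O'2: "y \<in> O' y" for y
    unfolding O'_def using U N1 by (auto simp: sym_nbhd_def)
  have O'3: "same z i j i' j'"
    if "same y i j i' j'" "z \<in> O' y" "i \<in> range c" "i' \<in> range c" "j \<in> {1..k}" "j' \<in> {1..k}"
    for y z i j i' j'
  proof -
    have "z \<in> U y i j i' j'" using that(2-) unfolding O'_def by blast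
    then show ?thesis using U[OF that(5,6), of y i i'] that(1) by blast
  qed
  obtain N2 d where N2: "sym_nbhd N2" and "finite (range d)"
    and d: "\<And>z x. x - z \<in> N2 \<Longrightarrow> x \<in> O' (d z)"
    by (rule Lebesgue_nbhd[where O' = O', OF comp O'1 O'2]) (rule that, assumption, assumption, simp)
  have N20: "0 \<in> N2" and N10: "0 \<in> N1" using N2 N1 by (auto simp: sym_nbhd_def)
  have gW: "g i j z \<in> V i j" "p (g i j z) = z" if "z \<in> W i" "j \<in> {1..k}" for i j z
    using that sheetD(2)[OF V(3)[OF that(2)]] unfolding g_def
    by (metis inv_into_into, metis f_inv_into_f)
  have gp: "g i j (p e) = e" if "e \<in> V i j" "j \<in> {1..k}" for i j e
    using that sheetD(3)[OF V(3)] unfolding g_def by auto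
  have Vsub: "V i j \<subseteq> topspace X" if "j \<in> {1..k}" for i j
    using that V(3) sheetD(1) by blast
  have exj: "\<exists>j\<in>{1..k}. e \<in> V i j" if "e \<in> topspace X" "p e \<in> W i" for e i
    using that V(1)[of i] by blast
  have uniq: "j = j'" if "e \<in> V i j" "e \<in> V i j'" "j \<in> {1..k}" "j' \<in> {1..k}" for e i j j'
    using that V(2)[of i] unfolding disjoint_family_on_def by blast
  have cW: "z \<in> W (c z)" for z using c(2)[of z z] N10 by simp
  define J where "J e = (SOME j. j \<in> {1..k} \<and> e \<in> V (c (p e)) j)" for e
  have J: "J e \<in> {1..k}" "e \<in> V (c (p e)) (J e)" if "e \<in> topspace X" for e
    using someI_ex[of "\<lambda>j. j \<in> {1..k} \<and> e \<in> V (c (p e)) j"] exj[OF that cW] unfolding J_def by blast+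
  define T where "T e = g (c (p e)) (J e)" for e
  \<comment> \<open>All points within one step of \<open>p e\<close> lie in \<open>O' (d (p e))\<close>, and the centre \<open>d (p e)\<close> of this set lies
    in every \<open>W\<close> that transport may choose at such a point; sheets are compared at that centre.\<close>
  have near: "d (p e) \<in> W (c z) \<and> z \<in> O' (d (p e))" if "z - p e \<in> N2" for e z
  proof -
    have "z \<in> O' (d (p e))" using d that by blast
    then have "z - d (p e) \<in> N1" by (auto simp: O'_def)
    then show ?thesis using \<open>z \<in> O' (d (p e))\<close> c(2) sym_nbhd_diff_commute[OF N1] by blast
  qed
  have inW: "z \<in> W (c (p e))" if e: "e \<in> topspace X" and z: "z - p e \<in> N2" for e z
  proof -
    have "same (d (p e)) (c (p e)) (J e) (c (p e)) (J e)"
      using near[of "p e" e] N20 unfolding same_def by simp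
    from O'3[OF this _ _ _ J(1)[OF e] J(1)[OF e]] near[OF z] show ?thesis unfolding same_def by blast
  qed
  have "transport X p N2 T"
  proof
    show "sym_nbhd N2" by fact
    fix e assume e: "e \<in> topspace X"
    show "T e (p e) = e" using gp J[OF e] unfolding T_def by blast
    show "T e y \<in> topspace X" "p (T e y) = y" if "y - p e \<in> N2" for y
      using gW[OF inW[OF e that] J(1)[OF e]] Vsub[OF J(1)[OF e]] unfolding T_def by auto
    show "continuous_map (subtopology euclidean {y. y - p e \<in> N2}) X (T e)"
      unfolding T_def g_def
      by (rule continuous_map_from_subtopology_mono[OF sheetD(4)[OF V(3)[OF J(1)[OF e]]]])
        (use inW[OF e] in blast)
    fix y z assume yz: "y - p e \<in> N2" "z - y \<in> N2" "z - p e \<in> N2"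
    let ?i = "c (p e)" and ?x = "d (p e)" and ?i' = "c y"
    have Te: "T e y \<in> topspace X" "p (T e y) = y" 
      using gW[OF inW[OF e yz(1)] J(1)[OF e]] Vsub[OF J(1)[OF e]] unfolding T_def by auto
    have xW: "?x \<in> W ?i" "?x \<in> W ?i'" using near[of "p e" e] near[OF yz(1)] N20 by simp_all
    \<comment> \<open>The sheet over \<open>W (c y)\<close> that meets the sheet of \<open>e\<close> above the centre is the one in which \<open>T e y\<close>
      continues.\<close>
    have gx: "g ?i (J e) ?x \<in> topspace X" "p (g ?i (J e) ?x) = ?x"
      using gW[OF xW(1) J(1)[OF e]] Vsub[OF J(1)[OF e]] by auto
    obtain j where j: "j \<in> {1..k}" "g ?i (J e) ?x \<in> V ?i' j"
      using exj[OF gx(1)] xW gx(2) by metis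
    have "same ?x ?i (J e) ?i' j"
      using xW gp[OF j(2,1)] gx(2) unfolding same_def by simp
    then have s: "same y ?i (J e) ?i' j" "same z ?i (J e) ?i' j"
      using near[OF yz(1)] near[OF yz(3)] J(1)[OF e] j(1) by (auto intro: O'3)
    have "g ?i' j y \<in> V ?i' j" using gW(1)[of y ?i' j] s(1) j(1) unfolding same_def by simp
    then have "T e y \<in> V ?i' j" using s(1) unfolding T_def same_def by simp
    moreover have "T e y \<in> V ?i' (J (T e y))" "J (T e y) \<in> {1..k}" using J[OF Te(1)] Te(2) by auto
    ultimately have "J (T e y) = j" using uniq j(1) by blast
    then show "T (T e y) z = T e z" using s(2) Te(2) unfolding T_def same_def by simp
  qed
  then show ?thesis using that by blast
qed

section \<open>Transport along chains of small steps\<close>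

fun chain :: "'a::ab_group_add set \<Rightarrow> 'a \<Rightarrow> 'a list \<Rightarrow> bool" where
  "chain M x [] \<longleftrightarrow> True"
| "chain M x (y # ys) \<longleftrightarrow> y - x \<in> M \<and> chain M y ys"

lemma chain_snoc: "chain M x (xs @ [y]) \<longleftrightarrow> chain M x xs \<and> y - last (x # xs) \<in> M"
  by (induction xs arbitrary: x) auto

lemma chain_append: "chain M x (xs @ ys) \<longleftrightarrow> chain M x xs \<and> chain M (last (x # xs)) ys"
  by (induction xs arbitrary: x) auto

text \<open>
  The points that can be reached by chains form a set that is open and whose complement is open.
\<close>

lemma connected_chain:
  fixes M :: "'a::topological_ab_group_add set"
  assumes conn: "connected (UNIV :: 'a set)" and M: "sym_nbhd M"
  obtains xs where "chain M x xs" "last (x # xs) = y"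
proof -
  define R where "R = {y. \<exists>xs. chain M x xs \<and> last (x # xs) = y}"
  have step: "z \<in> R" if "y \<in> R" "z - y \<in> M" for y z
  proof -
    from that(1) obtain xs where "chain M x xs" "last (x # xs) = y" unfolding R_def by blast
    then have "chain M x (xs @ [z])" "last (x # xs @ [z]) = z"
      using that(2) by (auto simp: chain_snoc)
    then show ?thesis unfolding R_def by blast
  qed
  have nb: "open {z. z - y \<in> M}" "y \<in> {z. z - y \<in> M}" for y
    using M open_translate(1) by (auto simp: sym_nbhd_def)
  have "\<exists>U. open U \<and> y \<in> U \<and> U \<subseteq> R" if "y \<in> R" for y
    using step[OF that] nb[of y] by (intro exI[of _ "{z. z - y \<in> M}"]) auto
  then have "open R" using open_subopen[of R] by blast
  have "\<exists>U. open U \<and> y \<in> U \<and> U \<subseteq> - R" if "y \<in> - R" for y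
    using step[of _ y] that nb[of y] sym_nbhd_diff_commute[OF M]
    by (intro exI[of _ "{z. z - y \<in> M}"]) auto
  then have "open (- R)" using open_subopen[of "- R"] by blast
  have "x \<in> R" unfolding R_def by (auto intro: exI[of _ "[]"])
  then have "y \<in> R"
    using connectedD[OF conn \<open>open R\<close> \<open>open (- R)\<close>] by blast
  then show ?thesis using that unfolding R_def by blast
qed

context transport
begin

lemma N_zero: "0 \<in> N" using N by (simp add: sym_nbhd_def)

lemma N_sym: "x - y \<in> N \<Longrightarrow> y - x \<in> N" using sym_nbhd_diff_commute[OF N] by blast

lemma T_back: "e \<in> topspace X \<Longrightarrow> y - p e \<in> N \<Longrightarrow> T (T e y) (p e) = e"
  using T_trans[of e y "p e"] N_sym N_zero T_self by simp

definition carry :: "('c \<Rightarrow> 'a) \<Rightarrow> 'b \<Rightarrow> 'c list \<Rightarrow> 'b" where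
  "carry h e xs = foldl (\<lambda>e x. T e (h x)) e xs"

lemma carry_simps [simp]:
  "carry h e [] = e" "carry h e (x # xs) = carry h (T e (h x)) xs"
  "carry h e (xs @ ys) = carry h (carry h e xs) ys"
  by (simp_all add: carry_def)

lemma carry_cong: "(\<And>x. x \<in> set xs \<Longrightarrow> h x = h' x) \<Longrightarrow> carry h e xs = carry h' e xs"
  by (induction xs arbitrary: e) auto

lemma carry_in:
  assumes "e \<in> topspace X" "p e = h x" "chain M x xs" "\<And>x x'. x' - x \<in> M \<Longrightarrow> h x' - h x \<in> N"
  shows "carry h e xs \<in> topspace X \<and> p (carry h e xs) = h (last (x # xs))"
  using assms
proof (induction xs arbitrary: e x)
  case (Cons y ys)
  have "h y - p e \<in> N" using Cons.prems by auto
  then show ?case using Cons.IH[of "T e (h y)" y] Cons.prems T_in p_T by auto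
qed auto

lemma carry_inj:
  assumes "e \<in> topspace X" "e' \<in> topspace X" "p e = h x" "p e' = h x" "chain M x xs"
    "\<And>x x'. x' - x \<in> M \<Longrightarrow> h x' - h x \<in> N" "carry h e xs = carry h e' xs"
  shows "e = e'"
  using assms
proof (induction xs arbitrary: e e' x)
  case (Cons y ys)
  have y: "h y - p e \<in> N" "h y - p e' \<in> N" using Cons.prems by auto
  have "T e (h y) = T e' (h y)"
    by (rule Cons.IH[of _ _ y]) (use Cons.prems y T_in p_T in auto)
  then show ?case using T_back y Cons.prems by metis
qed auto

lemma carry_const: "e \<in> topspace X \<Longrightarrow> carry (\<lambda>_. p e) e xs = e"
  by (induction xs) (auto simp: T_self)

text \<open>
  Discrete homotopy across a strip of small squares: moving from \<open>y\<close> to \<open>y'\<close> after transport along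
  \<open>h(\<cdot>, y)\<close> is the same as doing so before transport along \<open>h(\<cdot>, y')\<close>. Each square is split into two small
  triangles.
\<close>

lemma carry_square:
  assumes h: "\<And>x x' y y'. x' - x \<in> M \<Longrightarrow> y' - y \<in> M \<Longrightarrow> h x' y' - h x y \<in> N" and M: "0 \<in> M"
    and "chain M x xs" "y' - y \<in> M" "e \<in> topspace X" "p e = h x y"
  shows "T (carry (\<lambda>x. h x y) e xs) (h (last (x # xs)) y') =
         carry (\<lambda>x. h x y') (T e (h x y')) xs"
  using assms(3-)
proof (induction xs arbitrary: e x)
  case (Cons z zs)
  have M': "a - a \<in> M" for a :: 'c using M by simp
  have zx: "z - x \<in> M" using Cons.prems by simp
  have n: "h z y - p e \<in> N" "h x y' - p e \<in> N" "h z y' - p e \<in> N"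
    "h z y' - h z y \<in> N" "h z y' - h x y' \<in> N"
    using h[OF zx M'] h[OF M' Cons.prems(2)] h[OF zx Cons.prems(2)] Cons.prems(4) by auto
  have "T (T e (h z y)) (h z y') = T (T e (h x y')) (h z y')"
    using T_trans n Cons.prems by simp
  then show ?case
    using Cons.IH[of z "T e (h z y)"] Cons.prems T_in p_T n by auto
qed auto

text \<open>
  The diagonal of the grid \<open>h(x\<^sub>i, x\<^sub>j)\<close> is homotopic to its side \<open>h(x\<^sub>i, x\<^sub>0)\<close> followed by its side
  \<open>h(x\<^sub>r, x\<^sub>j)\<close>. This is what turns transport along the diagonal chain of a mean into a product of
  transports along its coordinate axes.
\<close>

lemma carry_diagonal:
  assumes h: "\<And>x x' y y'. x' - x \<in> M \<Longrightarrow> y' - y \<in> M \<Longrightarrow> h x' y' - h x y \<in> N" and M: "0 \<in> M"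
    and "chain M x xs" "e \<in> topspace X" "p e = h x x"
  shows "carry (\<lambda>x. h x x) e xs =
         carry (h (last (x # xs))) (carry (\<lambda>y. h y x) e xs) xs"
  using assms(3-)
proof (induction xs arbitrary: e x)
  case (Cons y ys)
  have M': "a - a \<in> M" for a :: 'c using M by simp
  have yx: "y - x \<in> M" using Cons.prems by simp
  let ?l = "last (y # ys)" and ?e = "T e (h y x)"
  have n: "h y y - p e \<in> N" "h y x - p e \<in> N" "h y y - h y x \<in> N"
    using h[OF yx M'] h[OF M' yx] h[OF yx yx] Cons.prems by auto
  have e: "?e \<in> topspace X" "p ?e = h y x" using n Cons.prems T_in p_T by auto
  have "T (carry (\<lambda>z. h z x) ?e ys) (h ?l y) = carry (\<lambda>z. h z y) (T ?e (h y y)) ys"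
    using carry_square[of M h y ys y x ?e] h M Cons.prems yx e by simp
  moreover have "T ?e (h y y) = T e (h y y)" using T_trans n Cons.prems by simp
  moreover have "carry (\<lambda>z. h z z) (T e (h y y)) ys =
      carry (h ?l) (carry (\<lambda>z. h z y) (T e (h y y)) ys) ys"
    using Cons.IH[of y "T e (h y y)"] Cons.prems T_in p_T n by auto
  ultimately show ?case by simp
qed auto

end

text \<open>
  The orbit of \<open>e\<close> has length at most \<open>k\<close>, and this length divides \<open>k!\<close>.
\<close>

lemma funpow_fact_fixes:
  assumes "finite F" "card F = k" "f ` F \<subseteq> F" "inj_on f F" "e \<in> F"
  shows "(f ^^ fact k) e = e"
proof -
  have in_F: "(f ^^ i) e \<in> F" for i using assms(3,5) by (induction i) auto
  have "\<not> inj_on (\<lambda>i. (f ^^ i) e) {..k}"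
  proof
    assume "inj_on (\<lambda>i. (f ^^ i) e) {..k}"
    then have "card {..k} \<le> card F" by (rule card_inj_on_le) (use in_F assms(1) in auto)
    then show False using assms(2) by simp
  qed
  then obtain i j where ij: "i < j" "j \<le> k" "(f ^^ i) e = (f ^^ j) e"
    unfolding inj_on_def by (metis atMost_iff linorder_neqE_nat)
  have inj: "inj_on (f ^^ n) F" for n
  proof (induction n)
    case (Suc n)
    have "(f ^^ n) ` F \<subseteq> F" using assms(3) by (induction n) auto
    then show ?case using comp_inj_on[OF Suc, of f] inj_on_subset[OF assms(4)] by (simp add: o_def)
  qed auto
  have "(f ^^ i) ((f ^^ (j - i)) e) = (f ^^ i) e"
    using ij funpow_add[of i "j - i" f] by simp
  then have fx: "(f ^^ (j - i)) e = e" using inj in_F assms(5) unfolding inj_on_def by blast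
  have "(j - i) dvd fact k" using ij by (intro dvd_fact) auto
  then obtain q where q: "fact k = q * (j - i)" by (metis dvdE mult.commute)
  have "((f ^^ (j - i)) ^^ q) e = e" using fx by (induction q) auto
  then show ?thesis using q by (simp add: funpow_mult mult.commute)
qed

section \<open>Means trivialise coverings\<close>

lemma (in transport) carry_reverse:
  assumes "chain M x ys" "M \<subseteq> N" "sym_nbhd M"
  obtains zs where "chain M (last (x # ys)) zs" "last (last (x # ys) # zs) = x"
    "\<And>e. e \<in> topspace X \<Longrightarrow> p e = x \<Longrightarrow> carry (\<lambda>x. x) (carry (\<lambda>x. x) e ys) zs = e"
proof -
  have "\<exists>zs. chain M (last (x # ys)) zs \<and> last (last (x # ys) # zs) = x \<and>
    (\<forall>e. e \<in> topspace X \<longrightarrow> p e = x \<longrightarrow> carry (\<lambda>x. x) (carry (\<lambda>x. x) e ys) zs = e)"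
    using assms(1)
  proof (induction ys arbitrary: x)
    case Nil
    then show ?case by (intro exI[of _ "[]"]) simp
  next
    case (Cons y ys)
    from Cons.prems have "chain M y ys" by simp
    from Cons.IH[OF this]
    obtain zs where zs: "chain M (last (y # ys)) zs" "last (last (y # ys) # zs) = y"
      "\<And>e. e \<in> topspace X \<Longrightarrow> p e = y \<Longrightarrow> carry (\<lambda>x. x) (carry (\<lambda>x. x) e ys) zs = e"
      by blast
    have yx: "y - x \<in> M" using Cons.prems by simp
    then have xy: "x - y \<in> M" using sym_nbhd_diff_commute[OF assms(3)] by blast
    have "chain M (last (y # ys)) (zs @ [x])" using zs(1,2) xy by (simp only: chain_snoc)
    moreover have "carry (\<lambda>x. x) (carry (\<lambda>x. x) e (y # ys)) (zs @ [x]) = e"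
      if e: "e \<in> topspace X" "p e = x" for e
    proof -
      have n: "y - p e \<in> N" using yx e assms(2) by auto
      have "carry (\<lambda>x. x) (carry (\<lambda>x. x) (T e y) ys) zs = T e y"
        by (rule zs(3)) (use n e T_in p_T in auto)
      then show ?thesis using T_back[OF e(1) n] e by simp
    qed
    ultimately show ?case by (intro exI[of _ "zs @ [x]"]) simp
  qed
  then show ?thesis using that by blast
qed

lemma fold_covering_fibre:
  assumes "fold_covering_map k X euclidean p"
  obtains en where "bij_betw en {1..k} {e \<in> topspace X. p e = y}"
proof -
  obtain W V where W: "open W" "y \<in> W"
    and V: "{x \<in> topspace X. p x \<in> W} = (\<Union>i\<in>{1..k}. V i)"
      "disjoint_family_on V {1..k}" "\<forall>i\<in>{1..k}. sheet X p (V i) W"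
    using fold_covering_sheets[OF assms, of y] by metis
  define en where "en i = inv_into (V i) p y" for i
  have en: "en i \<in> V i" "p (en i) = y" if "i \<in> {1..k}" for i
  proof -
    have "y \<in> p ` V i" using sheetD(2) V(3) that W(2) by blast
    then show "en i \<in> V i" "p (en i) = y" unfolding en_def by (rule inv_into_into, rule f_inv_into_f)
  qed
  have "bij_betw en {1..k} {e \<in> topspace X. p e = y}"
  proof (rule bij_betw_imageI)
    show "inj_on en {1..k}"
    proof (rule inj_onI)
      fix i j assume ij: "i \<in> {1..k}" "j \<in> {1..k}" "en i = en j"
      then have "V i \<inter> V j \<noteq> {}" using en(1)[of i] en(1)[of j] by auto
      then show "i = j" using V(2) ij unfolding disjoint_family_on_def by blast
    qed
    show "en ` {1..k} = {e \<in> topspace X. p e = y}"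
    proof (intro equalityI subsetI)
      fix e assume "e \<in> en ` {1..k}"
      then obtain i where i: "i \<in> {1..k}" "e = en i" by blast
      have "en i \<in> (\<Union>i\<in>{1..k}. V i)" using en(1) i(1) by blast
      then show "e \<in> {e \<in> topspace X. p e = y}" using en(2) i V(1) by blast
    next
      fix e assume e: "e \<in> {e \<in> topspace X. p e = y}"
      then have "e \<in> {x \<in> topspace X. p x \<in> W}" using W(2) by simp
      then obtain i where i: "i \<in> {1..k}" "e \<in> V i" using V(1) by auto
      then have "e = en i" using en[OF i(1)] e sheetD(3) V(3) unfolding inj_on_def by blast
      then show "e \<in> en ` {1..k}" using i by blast
    qed
  qed
  then show ?thesis using that by blast
qed

text \<open>
  When closed chains act trivially, transport from the fibre over \<open>0\<close> does not depend on the chain and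
  defines \<open>k\<close> global sections, continuous since near \<open>y\<close> they are given by one further transport step.
  Their union is a continuous bijection from a compact space to a Hausdorff space.
\<close>

lemma (in transport) loops_trivial_imp_trivial:
  assumes cov: "fold_covering_map k X euclidean p"
    and comp: "compact (UNIV :: 'a set)" and conn: "connected (UNIV :: 'a set)"
    and haus: "Hausdorff_space X"
    and M: "sym_nbhd M" "M \<subseteq> N"
    and loop: "\<And>e xs. e \<in> topspace X \<Longrightarrow> p e = 0 \<Longrightarrow> chain M 0 xs \<Longrightarrow> last (0 # xs) = 0 \<Longrightarrow>
                 carry (\<lambda>x. x) e xs = e"
  shows "trivial_fold_covering k X euclidean p"
proof -
  let ?c = "carry (\<lambda>x::'a. x)"
  have "\<forall>y. \<exists>xs. chain M 0 xs \<and> last (0 # xs) = y"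
    using connected_chain[OF conn M(1), where x = 0] by blast
  from choice[OF this] obtain path
    where path: "\<And>y. chain M 0 (path y)" "\<And>y. last (0 # path y) = y" by blast
  have idM: "x' - x \<in> M \<Longrightarrow> x' - x \<in> N" for x x' using M(2) by blast
  obtain en where en: "bij_betw en {1..k} {e \<in> topspace X. p e = 0}"
    using fold_covering_fibre[OF cov] by blast
  have enX: "en n \<in> topspace X" "p (en n) = 0" if "n \<in> {1..k}" for n
    using bij_betw_apply[OF en that] by auto
  have c_in: "?c e xs \<in> topspace X \<and> p (?c e xs) = last (x # xs)"
    if "e \<in> topspace X" "p e = x" "chain M x xs" for e x xs
    by (rule carry_in[where h = "\<lambda>x. x", OF that]) (rule idM)
  have c_inj: "e = e'"
    if "e \<in> topspace X" "e' \<in> topspace X" "p e = x" "p e' = x" "chain M x xs" "?c e xs = ?c e' xs"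
    for e e' x xs
    by (rule carry_inj[where h = "\<lambda>x. x", OF that(1-5) idM that(6)])
  have unique: "?c e xs = ?c e ys"
    if e: "e \<in> topspace X" "p e = 0" and xs: "chain M 0 xs" and ys: "chain M 0 ys"
      and l: "last (0 # xs) = last (0 # ys)" for e xs ys
  proof -
    obtain zs where zs: "chain M (last (0 # ys)) zs" "last (last (0 # ys) # zs) = 0"
      "\<And>e. e \<in> topspace X \<Longrightarrow> p e = 0 \<Longrightarrow> ?c (?c e ys) zs = e"
      using carry_reverse[OF ys M(2,1)] by blast
    have "chain M 0 (xs @ zs)" using xs zs(1) l by (simp only: chain_append)
    moreover have "last (0 # xs @ zs) = 0" using zs(2) l by (cases zs) auto
    ultimately have "?c e (xs @ zs) = e" by (rule loop[OF e])
    then have "?c (?c e xs) zs = ?c (?c e ys) zs" using zs(3)[OF e] by simp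
    then show ?thesis
      using c_in[OF e xs] c_in[OF e ys] l zs(1)
      by (intro c_inj[of "?c e xs" "?c e ys" "last (0 # ys)" zs]) (simp_all only:)
  qed
  define \<rho> where "\<rho> = (\<lambda>(y, n). ?c (en n) (path y))"
  have \<rho>: "\<rho> (y, n) \<in> topspace X \<and> p (\<rho> (y, n)) = y" if "n \<in> {1..k}" for y n
    using c_in[OF enX[OF that] path(1)] path(2) unfolding \<rho>_def by simp
  have inj: "n = n'" if "n \<in> {1..k}" "n' \<in> {1..k}" "\<rho> (y, n) = \<rho> (y, n')" for y n n'
  proof -
    have "en n = en n'"
      using c_inj[OF enX(1)[OF that(1)] enX(1)[OF that(2)] enX(2)[OF that(1)] enX(2)[OF that(2)]
          path(1)] that(3) unfolding \<rho>_def by simp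
    then show ?thesis using en that unfolding bij_betw_def inj_on_def by blast
  qed
  \<comment> \<open>Transport is injective and all fibres have \<open>k\<close> points.\<close>
  have surj: "\<exists>n\<in>{1..k}. e = \<rho> (y, n)" if e: "e \<in> topspace X" "p e = y" for e y
  proof -
    obtain en' where "bij_betw en' {1..k} {e \<in> topspace X. p e = y}"
      using fold_covering_fibre[OF cov] by blast
    then have F: "finite {e \<in> topspace X. p e = y}" "card {e \<in> topspace X. p e = y} = k"
      using bij_betw_finite[of en' "{1..k}"] bij_betw_same_card[of en' "{1..k}"] by simp_all
    have "(\<lambda>n. \<rho> (y, n)) ` {1..k} = {e \<in> topspace X. p e = y}"
    proof (rule card_subset_eq[OF F(1)])
      show "(\<lambda>n. \<rho> (y, n)) ` {1..k} \<subseteq> {e \<in> topspace X. p e = y}" using \<rho> by blast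
      show "card ((\<lambda>n. \<rho> (y, n)) ` {1..k}) = card {e \<in> topspace X. p e = y}"
        using F(2) inj by (subst card_image) (auto simp: inj_on_def)
    qed
    then show ?thesis using e by blast
  qed
  have step: "\<rho> (z, n) = T (\<rho> (y, n)) z" if n: "n \<in> {1..k}" and z: "z - y \<in> M" for y z n
  proof -
    have "chain M 0 (path y @ [z])" using path z by (simp only: chain_snoc)
    then have "?c (en n) (path z) = ?c (en n) (path y @ [z])"
      using unique[of "en n" "path z" "path y @ [z]"] enX[OF n] path by simp
    then show ?thesis unfolding \<rho>_def by simp
  qed
  have open_slice: "open {z. \<rho> (z, n) \<in> V}" if n: "n \<in> {1..k}" and V: "openin X V" for n V
  proof -
    have "\<exists>U. open U \<and> y \<in> U \<and> U \<subseteq> {z. \<rho> (z, n) \<in> V}" if y: "\<rho> (y, n) \<in> V" for y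
    proof -
      let ?e = "\<rho> (y, n)"
      have e: "?e \<in> topspace X" "p ?e = y" using \<rho>[OF n] by auto
      have "openin (subtopology euclidean {z. z - y \<in> N}) {z \<in> {z. z - y \<in> N}. T ?e z \<in> V}"
        using openin_continuous_map_preimage[OF T_cont[OF e(1)] V] e(2) by simp
      moreover have "open {z. z - y \<in> N}" using N open_translate(1) by (auto simp: sym_nbhd_def)
      ultimately have "open {z \<in> {z. z - y \<in> N}. T ?e z \<in> V}"
        by (simp add: openin_open_eq)
      moreover have "open {z. z - y \<in> M}" using M(1) open_translate(1) by (auto simp: sym_nbhd_def)
      ultimately have "open ({z. z - y \<in> M} \<inter> {z \<in> {z. z - y \<in> N}. T ?e z \<in> V})" (is "open ?U")
        by blast
      moreover have "y \<in> ?U"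
        using y T_self[OF e(1)] e(2) N_zero M(1) by (simp add: sym_nbhd_def)
      moreover have "?U \<subseteq> {z. \<rho> (z, n) \<in> V}"
      proof
        fix z assume z: "z \<in> ?U"
        then have "\<rho> (z, n) = T ?e z" using step[OF n, of z y] by simp
        then show "z \<in> {z. \<rho> (z, n) \<in> V}" using z by simp
      qed
      ultimately show ?thesis by blast
    qed
    then show ?thesis using open_subopen[of "{z. \<rho> (z, n) \<in> V}"] by blast
  qed
  let ?P = "prod_topology (euclidean :: 'a topology) (discrete_topology {1..k})"
  have "continuous_map ?P X \<rho>"
  proof -
    have "openin ?P {w \<in> topspace ?P. \<rho> w \<in> V}" if V: "openin X V" for V
    proof -
      have "openin ?P ({z. \<rho> (z, n) \<in> V} \<times> {n})" if "n \<in> {1..k}" for n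
        using open_slice[OF that V] that by (simp add: openin_prod_Times_iff)
      then have "openin ?P (\<Union>n\<in>{1..k}. {z. \<rho> (z, n) \<in> V} \<times> {n})" by (intro openin_Union) auto
      moreover have "(\<Union>n\<in>{1..k}. {z. \<rho> (z, n) \<in> V} \<times> {n}) = {w \<in> topspace ?P. \<rho> w \<in> V}" by auto
      ultimately show ?thesis by simp
    qed
    then show ?thesis using \<rho> unfolding continuous_map by auto
  qed
  moreover have "compact_space (euclidean :: 'a topology)" using comp by (simp add: compact_space_def)
  then have "compact_space ?P"
    by (simp add: compact_space_prod_topology compact_space_discrete_topology)
  moreover have "\<rho> ` topspace ?P = topspace X"
  proof (intro equalityI subsetI)
    fix e assume "e \<in> topspace X"
    then obtain n where "n \<in> {1..k}" "e = \<rho> (p e, n)" using surj by blast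
    then show "e \<in> \<rho> ` topspace ?P" by auto
  qed (use \<rho> in auto)
  moreover have "inj_on \<rho> (topspace ?P)"
  proof (rule inj_onI)
    fix v w assume vw: "v \<in> topspace ?P" "w \<in> topspace ?P" "\<rho> v = \<rho> w"
    obtain y n z n' where [simp]: "v = (y, n)" "w = (z, n')" by (cases v, cases w)
    have "y = z" using \<rho>[of n y] \<rho>[of n' z] vw by auto
    then show "v = w" using inj[of n n' y] vw by auto
  qed
  ultimately have "homeomorphic_map ?P X \<rho>"
    using continuous_imp_homeomorphic_map haus by blast
  then show ?thesis using \<rho> unfolding trivial_fold_covering_def by blast
qed

theorem mean_imp_coverings_trivial:
  fixes p :: "'b \<Rightarrow> 'a::topological_ab_group_add"
  assumes comp: "compact (UNIV :: 'a set)" and conn: "connected (UNIV :: 'a set)"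
    and mean: "is_mean (fact k) (euclidean :: 'a topology) \<mu>"
    and haus: "Hausdorff_space X" and cov: "fold_covering_map k X euclidean p"
  shows "trivial_fold_covering k X euclidean p"
proof -
  obtain N T where "transport X p N T" using covering_has_transport[OF comp cov] by blast
  then interpret transport X p N T .
  define m :: nat where "m = fact k"
  have m: "m \<ge> 1" unfolding m_def by simp
  \<comment> \<open>\<open>A s x y\<close> has \<open>x\<close> in the first \<open>s - 1\<close> places and \<open>y\<close> in place \<open>s\<close>. It interpolates between
    \<open>D (s - 1)\<close> at \<open>y = 0\<close> and \<open>D s\<close> at \<open>y = x\<close>, and \<open>D m\<close> is the identity.\<close>
  define A where "A s x y = \<mu> (\<lambda>i\<in>{1..m}. if i < s then x else if i = s then y else 0)" for s :: nat and x y
  define D where "D s x = \<mu> (\<lambda>i\<in>{1..m}. if i \<le> s then x else 0)" for s :: nat and x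
  note mu = mean[unfolded is_mean_def, folded m_def]
  have A_diag: "A s x x = D s x" for s x
    unfolding A_def D_def by (rule arg_cong[where f = \<mu>]) auto
  have A_0: "A s x 0 = D (s - 1) x" if "s \<ge> 1" for s x
    unfolding A_def D_def by (rule arg_cong[where f = \<mu>]) (use that in \<open>auto simp: restrict_def fun_eq_iff\<close>)
  have A_axis: "A s 0 y = A 1 0 y" if s: "s \<in> {1..m}" for s y
  proof -
    let ?g = "\<lambda>i\<in>{1..m}. if i < 1 then 0 else if i = 1 then y else (0::'a)"
    let ?t = "Transposition.transpose 1 s"
    have "?t permutes {1..m}" using s m by (intro permutes_swap_id) auto
    moreover have "?g \<in> {1..m} \<rightarrow>\<^sub>E topspace euclidean" by auto
    ultimately have "\<mu> (?g \<circ> ?t) = \<mu> ?g" using mu by blast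
    moreover have "?g \<circ> ?t = (\<lambda>i\<in>{1..m}. if i < s then 0 else if i = s then y else 0)"
      using s by (auto simp: fun_eq_iff Transposition.transpose_def)
    ultimately show ?thesis unfolding A_def by simp
  qed
  have D_0: "D 0 x = 0" for x
  proof -
    have "(\<lambda>i\<in>{1..m}. if i \<le> 0 then x else 0) = (\<lambda>i\<in>{1..m}. 0::'a)" by auto
    then show ?thesis using mu unfolding D_def by simp
  qed
  have D_m: "D m x = x" for x
  proof -
    have "(\<lambda>i\<in>{1..m}. if i \<le> m then x else 0) = (\<lambda>i\<in>{1..m}. x)" by auto
    then show ?thesis using mu unfolding D_def by simp
  qed
  have A_cont: "continuous_on UNIV (\<lambda>z. A s (fst z) (snd z))" for s
  proof -
    let ?f = "\<lambda>z i. if i < s then fst z else if i = s then snd z else (0::'a)"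
    have "continuous_map euclidean euclidean (\<lambda>z. ?f z i)" for i
    proof -
      consider "i < s" | "i = s" | "i > s" by linarith
      then show ?thesis by cases (auto intro: continuous_intros)
    qed
    then have "continuous_map euclidean (product_topology (\<lambda>_. euclidean) {1..m}) (\<lambda>z. restrict (?f z) {1..m})"
      by (auto simp: continuous_map_componentwise)
    then have "continuous_map euclidean euclidean (\<mu> \<circ> (\<lambda>z. restrict (?f z) {1..m}))"
      using mu continuous_map_compose by blast
    then show ?thesis unfolding A_def o_def by simp
  qed
  have "\<forall>s. \<exists>M. sym_nbhd M \<and> (\<forall>x x' y y'. x' - x \<in> M \<longrightarrow> y' - y \<in> M \<longrightarrow> A s x' y' - A s x y \<in> N)"
  proof
    fix s
    obtain M where "sym_nbhd M"
      "\<And>x x' y y'. x' - x \<in> M \<Longrightarrow> y' - y \<in> M \<Longrightarrow> A s x' y' - A s x y \<in> N"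
      using uniformly_continuous_pair[OF comp A_cont[of s] N] by blast
    then show "\<exists>M. sym_nbhd M \<and> (\<forall>x x' y y'. x' - x \<in> M \<longrightarrow> y' - y \<in> M \<longrightarrow> A s x' y' - A s x y \<in> N)"
      by blast
  qed
  from choice[OF this] obtain M' where M': "\<And>s. sym_nbhd (M' s)"
    "\<And>s x x' y y'. x' - x \<in> M' s \<Longrightarrow> y' - y \<in> M' s \<Longrightarrow> A s x' y' - A s x y \<in> N"
    by blast
  define M where "M = N \<inter> (\<Inter>s\<in>{1..m}. M' s)"
  have M: "sym_nbhd M" 
    using N sym_nbhd_INT[of "{1..m}" M'] M'(1) unfolding M_def by (auto simp: sym_nbhd_def)
  have MA: "A s x' y' - A s x y \<in> N" if "s \<in> {1..m}" "x' - x \<in> M" "y' - y \<in> M" for s x x' y y'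
    using M'(2)[of x' x s y' y] that unfolding M_def by blast
  have M0: "0 \<in> M" using M by (simp add: sym_nbhd_def)
  have "carry (\<lambda>x. x) e xs = e"
    if e: "e \<in> topspace X" "p e = 0" and xs: "chain M 0 xs" "last (0 # xs) = 0" for e xs
  proof -
    define F where "F = {e \<in> topspace X. p e = 0}"
    let ?f = "\<lambda>e. carry (A 1 0) e xs"
    have A10: "A 1 0 0 = 0" using A_0[of 1 0] D_0 by simp
    have MA1: "A 1 0 x' - A 1 0 x \<in> N" if "x' - x \<in> M" for x x'
      using MA[of 1 0 0 x' x] m M0 that by simp
    obtain en where en: "bij_betw en {1..k} F"
      using fold_covering_fibre[OF cov] unfolding F_def by blast
    have F: "finite F" "card F = k"
      using bij_betw_finite[OF en] bij_betw_same_card[OF en] by auto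
    have fF: "?f e \<in> F" if "e \<in> F" for e
      using carry_in[of e "A 1 0" 0 M xs] that xs MA1 A10 unfolding F_def by auto
    have "inj_on ?f F"
      using carry_inj[of _ _ "A 1 0" 0 M xs] xs(1) MA1 A10 unfolding F_def inj_on_def by auto
    then have fact: "(?f ^^ m) e = e"
      unfolding m_def using F fF e by (intro funpow_fact_fixes[of F]) (auto simp: F_def)
    \<comment> \<open>Along a closed chain at \<open>0\<close> the last side of the grid is \<open>A s 0\<close>, that is \<open>A 1 0\<close> for every \<open>s\<close>.\<close>
    have "carry (D s) e xs = (?f ^^ s) e" if "s \<le> m" for s
      using that
    proof (induction s)
      case 0
      have "carry (D 0) e xs = carry (\<lambda>_. p e) e xs" by (rule carry_cong) (simp add: D_0 e)
      then show ?case using carry_const[OF e(1)] by simp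
    next
      case (Suc s)
      have S: "Suc s \<in> {1..m}" using Suc.prems by auto
      have p0: "p e = A (Suc s) 0 0" using A_axis[OF S] A10 e by simp
      have "carry (\<lambda>x. A (Suc s) x x) e xs =
          carry (A (Suc s) (last (0 # xs))) (carry (\<lambda>y. A (Suc s) y 0) e xs) xs"
        by (rule carry_diagonal[where h = "A (Suc s)", OF MA[OF S] M0 xs(1) e(1) p0])
      moreover have "(\<lambda>y. A (Suc s) y 0) = D s" using A_0[of "Suc s"] by auto
      moreover have "A (Suc s) (last (0 # xs)) = A 1 0" using A_axis[OF S] xs(2) by auto
      moreover have "(\<lambda>x. A (Suc s) x x) = D (Suc s)" using A_diag by auto
      ultimately show ?case using Suc by simp
    qed
    moreover have "D m = (\<lambda>x. x)" using D_m by auto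
    ultimately show ?thesis using fact by (metis order_refl)
  qed
  then show ?thesis
    using loops_trivial_imp_trivial[OF cov comp conn haus M] unfolding M_def by blast
qed

corollary mean_imp_all_fold_coverings_trivial:
  assumes comp: "compact (UNIV :: 'a::topological_ab_group_add set)" and conn: "connected (UNIV :: 'a set)"
    and mean: "admits_mean (fact k) (euclidean :: 'a topology)"
  shows "all_fold_coverings_trivial TYPE('b) k (euclidean :: 'a topology)"
proof -
  obtain \<mu> where "is_mean (fact k) (euclidean :: 'a topology) \<mu>"
    using mean unfolding admits_mean_def by (elim exE)
  then show ?thesis
    unfolding all_fold_coverings_trivial_def
    by (intro allI impI) (rule mean_imp_coverings_trivial[OF comp conn])
qed

section \<open>Characters of \<open>(\<int>/n)\<^sup>W\<close> and the lemma of Bogolyubov\<close>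

text \<open>
  The character of \<open>(\<int>/n)\<^sup>W\<close> with frequency \<open>t\<close>. Its argument ranges over integer vectors, which
  avoids reduction modulo \<open>n\<close> when arguments are added.
\<close>

definition character :: "nat \<Rightarrow> 'i set \<Rightarrow> ('i \<Rightarrow> nat) \<Rightarrow> ('i \<Rightarrow> int) \<Rightarrow> complex" where
  "character n W t v = (\<Prod>w\<in>W. cis (2 * pi * real_of_int (int (t w) * v w) / real n))"

lemma character_add: "character n W t (\<lambda>w. u w + v w) = character n W t u * character n W t v"
  unfolding character_def
  by (simp add: prod.distrib[symmetric] cis_mult distrib_left add_divide_distrib)

lemma character_minus: "character n W t (\<lambda>w. - v w) = cnj (character n W t v)"
  unfolding character_def by (simp add: cis_cnj)

lemma norm_character [simp]: "cmod (character n W t v) = 1"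
  unfolding character_def by (simp add: prod_norm[symmetric])

lemma sum_cis_roots:
  fixes a :: int
  assumes "n \<ge> 1"
  shows "(\<Sum>j<n. cis (2 * pi * real_of_int (int j * a) / real n)) = (if int n dvd a then of_nat n else 0)"
proof -
  let ?z = "cis (2 * pi * real_of_int a / real n)"
  have pow: "cis (2 * pi * real_of_int (int j * a) / real n) = ?z ^ j" for j
    unfolding Complex.DeMoivre by (rule arg_cong[where f = cis]) simp
  show ?thesis
  proof (cases "int n dvd a")
    case True
    then obtain b where "a = int n * b" by blast
    then have "2 * pi * real_of_int a / real n = 2 * pi * real_of_int b" using assms by simp
    then have "?z = 1" by (metis cis_multiple_2pi Ints_of_int)
    then show ?thesis using True by (simp only: pow) simp
  next
    case False
    have "?z \<noteq> 1"
    proof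
      assume "?z = 1"
      then have "exp (\<i> * of_real (2 * pi * real_of_int a / real n)) = 1" by (simp add: cis_conv_exp)
      then obtain b :: int where "2 * pi * real_of_int a / real n = of_int (2 * b) * pi"
        unfolding exp_eq_1 by auto
      then have "real_of_int a = real_of_int (b * int n)" using assms by (simp add: field_simps)
      then have "a = b * int n" by linarith
      then show False using False by simp
    qed
    moreover have "?z ^ n = 1"
    proof -
      have "real n * (2 * pi * real_of_int a / real n) = 2 * pi * real_of_int a" using assms by simp
      then show ?thesis using cis_multiple_2pi[of "real_of_int a"] by (simp add: Complex.DeMoivre)
    qed
    ultimately show ?thesis using False geometric_sum[of ?z n] by (simp only: pow) simp
  qed
qed

lemma character_orthogonality:
  assumes "finite W" "n \<ge> 1"
  shows "(\<Sum>t\<in>W \<rightarrow>\<^sub>E {..<n}. character n W t v) =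
           (if \<forall>w\<in>W. int n dvd v w then of_nat (n ^ card W) else 0)"
proof -
  have "(\<Sum>t\<in>W \<rightarrow>\<^sub>E {..<n}. character n W t v) =
        (\<Prod>w\<in>W. \<Sum>j<n. cis (2 * pi * real_of_int (int j * v w) / real n))"
    unfolding character_def using assms(1) by (subst prod_sum_PiE) auto
  also have "\<dots> = (\<Prod>w\<in>W. if int n dvd v w then of_nat n else 0)"
    by (simp only: sum_cis_roots[OF assms(2)])
  also have "\<dots> = (if \<forall>w\<in>W. int n dvd v w then of_nat (n ^ card W) else 0)"
    using assms(1) by (auto simp: prod_zero_iff)
  finally show ?thesis .
qed

text \<open>
  The Fourier series with coefficients \<open>\<bar>F(t)\<bar>\<^sup>2\<close>, where \<open>F\<close> is the transform of the family \<open>f\<close>, counts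
  modulo \<open>n\<close>, up to the order of the group, the representations of \<open>- c\<close> as a difference of two
  members of the family. For \<open>c = 0\<close> this is
  Parseval's identity; for the family of sums \<open>a + b\<close> it counts the representations of \<open>- c\<close> by
  \<open>a + b - a' - b'\<close>.
\<close>

lemma sum_norm_character:
  fixes f :: "'p \<Rightarrow> 'i \<Rightarrow> int"
  assumes "finite W" "n \<ge> 1" "finite P"
  shows "(\<Sum>t\<in>W \<rightarrow>\<^sub>E {..<n}. of_real ((cmod (\<Sum>p\<in>P. character n W t (f p)))\<^sup>2) * character n W t c) =
    of_nat (n ^ card W * card {(p, q) \<in> P \<times> P. \<forall>w\<in>W. int n dvd f p w - f q w + c w})"
proof -
  have "(\<Sum>t\<in>W \<rightarrow>\<^sub>E {..<n}. of_real ((cmod (\<Sum>p\<in>P. character n W t (f p)))\<^sup>2) * character n W t c) =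
     (\<Sum>t\<in>W \<rightarrow>\<^sub>E {..<n}. \<Sum>z\<in>P \<times> P. character n W t (\<lambda>w. f (fst z) w - f (snd z) w + c w))"
  proof (rule sum.cong[OF refl])
    fix t
    have "of_real ((cmod (\<Sum>p\<in>P. character n W t (f p)))\<^sup>2) * character n W t c =
      (\<Sum>p\<in>P. character n W t (f p)) * (\<Sum>q\<in>P. character n W t (\<lambda>w. - f q w)) * character n W t c"
      unfolding complex_norm_square by (simp add: character_minus)
    also have "\<dots> = (\<Sum>z\<in>P \<times> P. character n W t (f (fst z)) * character n W t (\<lambda>w. - f (snd z) w)
                      * character n W t c)"
      unfolding sum_product sum.cartesian_product
      by (subst sum_distrib_right) (simp add: case_prod_beta)
    also have "\<dots> = (\<Sum>z\<in>P \<times> P. character n W t (\<lambda>w. f (fst z) w - f (snd z) w + c w))"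
      by (simp add: character_add[symmetric] algebra_simps)
    finally show "of_real ((cmod (\<Sum>p\<in>P. character n W t (f p)))\<^sup>2) * character n W t c = \<dots>" .
  qed
  also have "\<dots> = (\<Sum>z\<in>P \<times> P. \<Sum>t\<in>W \<rightarrow>\<^sub>E {..<n}. character n W t (\<lambda>w. f (fst z) w - f (snd z) w + c w))"
    by (rule sum.swap)
  also have "\<dots> = (\<Sum>z\<in>P \<times> P. if \<forall>w\<in>W. int n dvd f (fst z) w - f (snd z) w + c w
                              then of_nat (n ^ card W) else 0)"
    by (simp only: character_orthogonality[OF assms(1,2)])
  also have "\<dots> = of_nat (n ^ card W * card {z \<in> P \<times> P. \<forall>w\<in>W. int n dvd f (fst z) w - f (snd z) w + c w})"
    using assms(3) by (subst sum.If_cases) (auto simp: Int_def)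
  also have "{z \<in> P \<times> P. \<forall>w\<in>W. int n dvd f (fst z) w - f (snd z) w + c w} =
     {(p, q) \<in> P \<times> P. \<forall>w\<in>W. int n dvd f p w - f q w + c w}" by auto
  finally show ?thesis .
qed

text \<open>
  Let \<open>R\<close> be the set of frequencies at which the transform \<open>F\<close> of \<open>S\<close> is large, in the sense that
  \<open>\<bar>F(t)\<bar>\<^sup>2 \<ge> \<bar>S\<bar>\<^sup>2 / (2 L)\<close>. Parseval bounds the number of such \<open>t\<close> by \<open>2 L\<^sup>2\<close>, whatever \<open>W\<close> is. If all
  characters in \<open>R\<close> are trivial at \<open>c\<close>, then the large frequencies, among them \<open>t = 0\<close> with
  \<open>\<bar>F(0)\<bar>\<^sup>4 = \<bar>S\<bar>\<^sup>4\<close>, contribute at least \<open>\<bar>S\<bar>\<^sup>4\<close> to the sum that counts representations of \<open>c\<close>, and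
  the small ones at most \<open>\<bar>S\<bar>\<^sup>4 / 2\<close> in absolute value. So the count is not zero.
\<close>

theorem Bogolyubov:
  assumes W: "finite W" and n: "n \<ge> 1" and S: "S \<subseteq> W \<rightarrow>\<^sub>E {..<n}"
    and big: "n ^ card W \<le> L * card S"
  shows "\<exists>R \<subseteq> W \<rightarrow>\<^sub>E {..<n}. card R \<le> 2 * L\<^sup>2 \<and>
    (\<forall>c. (\<forall>t\<in>R. character n W t c = 1) \<longrightarrow>
       (\<exists>a\<in>S. \<exists>b\<in>S. \<exists>a'\<in>S. \<exists>b'\<in>S. \<forall>w\<in>W. int n dvd int (a w) + int (b w) - (int (a' w) + int (b' w)) - c w))"
proof -
  define V where "V = W \<rightarrow>\<^sub>E {..<n}"
  define v where "v = real (n ^ card W)"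
  define s where "s = real (card S)"
  define F where "F t = (\<Sum>a\<in>S. character n W t (\<lambda>w. int (a w)))" for t
  define G where "G t = (cmod (F t))\<^sup>2" for t
  define R where "R = {t \<in> V. s\<^sup>2 \<le> 2 * real L * G t}"
  have finV: "finite V" unfolding V_def using W by (simp add: finite_PiE)
  have finS: "finite S" using S finV unfolding V_def by (rule finite_subset)
  have v: "v > 0" unfolding v_def using n by simp
  have vs: "v \<le> real L * s" unfolding v_def s_def using big by (metis of_nat_le_iff of_nat_mult)
  have s: "s > 0" using v vs unfolding s_def by (cases "card S") auto
  have L: "real L > 0" using v vs by (cases L) auto
  have G0: "G t \<ge> 0" for t unfolding G_def by simp
  have parseval: "(\<Sum>t\<in>V. G t) = v * s"
  proof -
    have "complex_of_real (\<Sum>t\<in>V. G t) = (\<Sum>t\<in>V. of_real ((cmod (F t))\<^sup>2) * character n W t (\<lambda>_. 0))"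
      unfolding G_def character_def by simp
    also have "\<dots> = of_nat (n ^ card W * card {(a, b) \<in> S \<times> S. \<forall>w\<in>W. int n dvd int (a w) - int (b w) + 0})"
      unfolding F_def V_def by (rule sum_norm_character[OF W n finS])
    also have "{(a, b) \<in> S \<times> S. \<forall>w\<in>W. int n dvd int (a w) - int (b w) + 0} = (\<lambda>a. (a, a)) ` S"
    proof -
      have "a = b" if ab: "a \<in> S" "b \<in> S" and d: "\<forall>w\<in>W. int n dvd int (a w) - int (b w)" for a b
      proof (rule PiE_ext)
        show "a \<in> W \<rightarrow>\<^sub>E {..<n}" "b \<in> W \<rightarrow>\<^sub>E {..<n}" using S ab by auto
        fix w assume w: "w \<in> W"
        then have lt: "a w < n" "b w < n" using S ab by (metis PiE_mem lessThan_iff subsetD)+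
        have "int (a w) mod int n = int (b w) mod int n" using d w by (simp add: mod_eq_dvd_iff)
        then show "a w = b w" using lt by simp
      qed
      then show ?thesis by auto
    qed
    also have "card ((\<lambda>a. (a, a)) ` S) = card S" by (rule card_image) (auto simp: inj_on_def)
    finally have "complex_of_real (\<Sum>t\<in>V. G t) = complex_of_real (v * s)" unfolding v_def s_def by simp
    then show ?thesis by (simp only: of_real_eq_iff)
  qed
  show ?thesis
  proof (intro exI[of _ R] conjI allI impI)
    show "R \<subseteq> W \<rightarrow>\<^sub>E {..<n}" unfolding R_def V_def by blast
    have "real (card R) * s\<^sup>2 = (\<Sum>t\<in>R. s\<^sup>2)" by simp
    also have "\<dots> \<le> (\<Sum>t\<in>R. 2 * real L * G t)" by (rule sum_mono) (simp add: R_def)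
    also have "\<dots> \<le> (\<Sum>t\<in>V. 2 * real L * G t)"
      by (rule sum_mono2[OF finV]) (use G0 in \<open>auto simp: R_def\<close>)
    also have "\<dots> = 2 * real L * (v * s)" using parseval by (simp add: sum_distrib_left[symmetric])
    also have "\<dots> \<le> 2 * real L * (real L * s * s)"
      using vs s L by (intro mult_left_mono mult_right_mono) auto
    finally have "real (card R) * s\<^sup>2 \<le> real (2 * L\<^sup>2) * s\<^sup>2" by (simp add: power2_eq_square mult_ac)
    then have "real (card R) \<le> real (2 * L\<^sup>2)" using s by simp
    then show "card R \<le> 2 * L\<^sup>2" by linarith
  next
    fix c assume c: "\<forall>t\<in>R. character n W t c = 1"
    show "\<exists>a\<in>S. \<exists>b\<in>S. \<exists>a'\<in>S. \<exists>b'\<in>S. \<forall>w\<in>W. int n dvd int (a w) + int (b w) - (int (a' w) + int (b' w)) - c w"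
    proof (rule ccontr)
      assume no: "\<not> ?thesis"
      let ?f = "\<lambda>p w. int (fst p w) + int (snd p w)"
      have F2: "(\<Sum>p\<in>S \<times> S. character n W t (?f p)) = (F t)\<^sup>2" for t
        unfolding F_def power2_eq_square
        by (simp add: character_add sum_product sum.cartesian_product case_prod_beta)
      have "{(p, q) \<in> (S \<times> S) \<times> (S \<times> S). \<forall>w\<in>W. int n dvd ?f p w - ?f q w + - c w} = {}"
        using no by auto
      then have "(\<Sum>t\<in>V. of_real ((cmod ((F t)\<^sup>2))\<^sup>2) * character n W t (\<lambda>w. - c w)) = 0"
        using sum_norm_character[OF W n finite_cartesian_product[OF finS finS], of ?f "\<lambda>w. - c w"]
        unfolding V_def by (simp only: F2 card.empty) simp
      then have zero: "(\<Sum>t\<in>V. of_real ((G t)\<^sup>2) * character n W t (\<lambda>w. - c w)) = 0"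
        by (simp add: G_def norm_power power_mult[symmetric])
      have one: "character n W t (\<lambda>w. - c w) = 1" if "t \<in> R" for t
        using c that by (simp add: character_minus)
      have RV: "R \<subseteq> V" and finR: "finite R" using finV unfolding R_def by auto
      have "complex_of_real (\<Sum>t\<in>R. (G t)\<^sup>2) = - (\<Sum>t\<in>V - R. of_real ((G t)\<^sup>2) * character n W t (\<lambda>w. - c w))"
      proof -
        have "(\<Sum>t\<in>R. of_real ((G t)\<^sup>2) * character n W t (\<lambda>w. - c w)) = complex_of_real (\<Sum>t\<in>R. (G t)\<^sup>2)"
          unfolding of_real_sum by (rule sum.cong[OF refl]) (simp only: one mult_1_right)
        then have "(\<Sum>t\<in>V - R. of_real ((G t)\<^sup>2) * character n W t (\<lambda>w. - c w)) + complex_of_real (\<Sum>t\<in>R. (G t)\<^sup>2) = 0"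
          using zero sum.subset_diff[OF RV finV, of "\<lambda>t. of_real ((G t)\<^sup>2) * character n W t (\<lambda>w. - c w)"]
          by (simp only:)
        then show ?thesis by (simp only: eq_neg_iff_add_eq_0 add.commute)
      qed
      then have "cmod (complex_of_real (\<Sum>t\<in>R. (G t)\<^sup>2)) =
          cmod (\<Sum>t\<in>V - R. of_real ((G t)\<^sup>2) * character n W t (\<lambda>w. - c w))"
        by (simp only: norm_minus_cancel)
      then have "(\<Sum>t\<in>R. (G t)\<^sup>2) \<le> cmod (\<Sum>t\<in>V - R. of_real ((G t)\<^sup>2) * character n W t (\<lambda>w. - c w))"
        unfolding norm_of_real by linarith
      also have "\<dots> \<le> (\<Sum>t\<in>V - R. cmod (of_real ((G t)\<^sup>2) * character n W t (\<lambda>w. - c w)))"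
        by (rule norm_sum)
      also have "\<dots> = (\<Sum>t\<in>V - R. (G t)\<^sup>2)" by (simp add: norm_mult norm_power)
      also have "\<dots> \<le> (\<Sum>t\<in>V - R. s\<^sup>2 / (2 * real L) * G t)"
      proof (rule sum_mono)
        fix t assume "t \<in> V - R"
        then have "G t \<le> s\<^sup>2 / (2 * real L)" using L by (auto simp: R_def field_simps)
        then show "(G t)\<^sup>2 \<le> s\<^sup>2 / (2 * real L) * G t"
          unfolding power2_eq_square[of "G t"] by (rule mult_right_mono[OF _ G0])
      qed
      also have "\<dots> \<le> (\<Sum>t\<in>V. s\<^sup>2 / (2 * real L) * G t)"
        by (rule sum_mono2[OF finV]) (use G0 L in auto)
      also have "\<dots> = s\<^sup>2 / (2 * real L) * (v * s)" unfolding parseval[symmetric] by (rule sum_distrib_left[symmetric])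
      also have "\<dots> \<le> s\<^sup>2 / (2 * real L) * (real L * s * s)"
        using vs s L by (intro mult_left_mono mult_right_mono) auto
      also have "\<dots> = s ^ 4 / 2" using L by (simp add: field_simps power2_eq_square power4_eq_xxxx)
      finally have le: "(\<Sum>t\<in>R. (G t)\<^sup>2) \<le> s ^ 4 / 2" .
      define t0 where "t0 = (\<lambda>w\<in>W. 0::nat)"
      have Gt0: "G t0 = s\<^sup>2" unfolding G_def F_def t0_def character_def s_def by simp
      have "1 * s\<^sup>2 \<le> 2 * real L * s\<^sup>2" using L by (intro mult_right_mono) auto
      moreover have "t0 \<in> V" using n unfolding t0_def V_def by simp
      ultimately have "t0 \<in> R" unfolding R_def using Gt0 by simp
      then have "(G t0)\<^sup>2 \<le> (\<Sum>t\<in>R. (G t)\<^sup>2)" by (intro member_le_sum finR) auto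
      then have "s ^ 4 \<le> (\<Sum>t\<in>R. (G t)\<^sup>2)" unfolding Gt0 by (simp add: power_mult[symmetric])
      moreover have "0 < s ^ 4" using s by simp
      ultimately show False using le by linarith
    qed
  qed
qed

section \<open>Subgroups of finite index inside \<open>S + S - S - S\<close>\<close>

definition nmul :: "nat \<Rightarrow> 'a::comm_monoid_add \<Rightarrow> 'a" where
  "nmul n x = (\<Sum>i<n. x)"

lemma nmul_simps [simp]: "nmul 0 x = 0" "nmul (Suc n) x = nmul n x + x" "nmul n 0 = 0"
  by (simp_all add: nmul_def)

lemma nmul_plus: "nmul n (x + y) = nmul n x + nmul n y"
  by (simp add: nmul_def sum.distrib)

lemma nmul_diff: "nmul n (x - y) = nmul n x - nmul n (y :: 'a::ab_group_add)"
  by (simp add: nmul_def sum_subtractf)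

lemma nmul_add_left: "nmul (m + n) x = nmul m x + nmul n x"
  by (induction n) (simp_all add: add.assoc)

lemma nmul_mult: "nmul (m * n) x = nmul m (nmul n x)"
  by (induction m) (simp_all add: nmul_add_left add.commute)

lemma nmul_sum: "nmul n (\<Sum>w\<in>W. f w) = (\<Sum>w\<in>W. nmul n (f w))"
  unfolding nmul_def by (rule sum.swap)

definition add_subgroup :: "'a::ab_group_add set \<Rightarrow> bool" where
  "add_subgroup H \<longleftrightarrow> 0 \<in> H \<and> (\<forall>x\<in>H. \<forall>y\<in>H. x - y \<in> H)"

lemma add_subgroupD:
  assumes "add_subgroup H"
  shows "0 \<in> H" "x \<in> H \<Longrightarrow> y \<in> H \<Longrightarrow> x - y \<in> H" "x \<in> H \<Longrightarrow> - x \<in> H"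
    "x \<in> H \<Longrightarrow> y \<in> H \<Longrightarrow> x + y \<in> H" "x \<in> H \<Longrightarrow> nmul n x \<in> H"
proof -
  show z: "0 \<in> H" and d: "x \<in> H \<Longrightarrow> y \<in> H \<Longrightarrow> x - y \<in> H" for x y
    using assms unfolding add_subgroup_def by auto
  show m: "x \<in> H \<Longrightarrow> - x \<in> H" for x using d[OF z] by simp
  show a: "x \<in> H \<Longrightarrow> y \<in> H \<Longrightarrow> x + y \<in> H" for x y using d[of x "- y"] m by simp
  show "x \<in> H \<Longrightarrow> nmul n x \<in> H" using z a by (induction n) auto
qed

lemma add_subgroup_sum:
  "add_subgroup H \<Longrightarrow> (\<And>w. w \<in> W \<Longrightarrow> f w \<in> H) \<Longrightarrow> (\<Sum>w\<in>W. f w) \<in> H"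
  by (induction W rule: infinite_finite_induct) (auto simp: add_subgroupD)

lemma add_subgroup_group_closure: "add_subgroup (group_closure X)"
  unfolding add_subgroup_def by (auto intro: group_closure.diff)

lemma group_closure_subset:
  assumes "add_subgroup H" "X \<subseteq> H" shows "group_closure X \<subseteq> H"
proof
  fix x assume "x \<in> group_closure X"
  then show "x \<in> H" by induction (use assms add_subgroupD in blast)+
qed

lemma group_closure_mono: "X \<subseteq> Y \<Longrightarrow> group_closure X \<subseteq> group_closure Y"
  by (rule group_closure_subset[OF add_subgroup_group_closure]) (auto intro: group_closure.base)

text \<open>
  A subgroup of finite index is encoded by a colouring with finitely many colours: the subgroup
  generated by the differences of equally coloured elements has at most as many cosets as there are
  colours. In this form the statement about all of \<open>A\<close> is a limit of statements about finite subsets.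
\<close>

definition monochromatic_diffs :: "('a::ab_group_add \<Rightarrow> 'c) \<Rightarrow> 'a set \<Rightarrow> 'a set" where
  "monochromatic_diffs \<kappa> W = {x - y | x y. x \<in> W \<and> y \<in> W \<and> \<kappa> x = \<kappa> y}"

lemma monochromatic_diffs_cong:
  assumes "\<And>x. x \<in> W \<Longrightarrow> \<kappa> x = \<kappa>' x"
  shows "monochromatic_diffs \<kappa> W = monochromatic_diffs \<kappa>' W"
  unfolding monochromatic_diffs_def by (intro Collect_cong ex_cong1) (auto simp: assms)

text \<open>
  Pull \<open>S\<close> back along the map \<open>\<phi>\<close> from \<open>(\<int>/n)\<^sup>W\<close> to \<open>A/nA\<close> that sends the basis vector \<open>\<delta> w\<close> to \<open>w\<close>.
  Translation by \<open>f \<in> W\<close> lifts to translation by \<open>\<delta> f\<close>, so the preimage \<open>S'\<close> has density at least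
  \<open>1 / \<bar>F\<bar>\<close> and Bogolyubov's lemma applies to it. Colour \<open>x\<close> by the values at \<open>\<delta> x\<close> of the few
  characters that it provides: differences of equally coloured elements are images of vectors killed
  by these characters. The number of colours does not depend on \<open>W\<close>.
\<close>

lemma colouring_finite:
  fixes A S F :: "'a::ab_group_add set"
  assumes A: "add_subgroup A" and n: "n \<ge> 1"
    and S: "S \<subseteq> A" "\<And>x z. x \<in> S \<Longrightarrow> z \<in> A \<Longrightarrow> x + nmul n z \<in> S"
    and F: "finite F" "F \<subseteq> A" "\<And>x. x \<in> A \<Longrightarrow> \<exists>f\<in>F. x - f \<in> S"
    and W: "finite W" "W \<subseteq> A" "F \<subseteq> W"
  shows "\<exists>\<kappa> :: 'a \<Rightarrow> nat. (\<forall>x\<in>W. \<kappa> x < n ^ (2 * (card F)\<^sup>2)) \<and>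
    group_closure (monochromatic_diffs \<kappa> W) \<subseteq> {a + b - a' - b' | a b a' b'. a \<in> S \<and> b \<in> S \<and> a' \<in> S \<and> b' \<in> S}"
proof -
  define \<phi> where "\<phi> c = (\<Sum>w\<in>W. nmul (c w) w)" for c :: "'a \<Rightarrow> nat"
  define \<delta> where "\<delta> x = (\<lambda>w. if w = x then 1 else 0 :: nat)" for x :: 'a
  define V where "V = W \<rightarrow>\<^sub>E {..<n}"
  define S' where "S' = {c \<in> V. \<phi> c \<in> S}"
  note Ad = add_subgroupD[OF A]
  have \<phi>_A: "\<phi> c \<in> A" for c
    unfolding \<phi>_def using W(2) Ad(5) by (intro add_subgroup_sum[OF A]) blast
  have \<phi>_add: "\<phi> (\<lambda>w. c w + d w) = \<phi> c + \<phi> d" for c d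
    unfolding \<phi>_def by (simp add: nmul_add_left sum.distrib)
  have \<phi>_mult: "\<phi> (\<lambda>w. m * c w) = nmul m (\<phi> c)" for m c
    unfolding \<phi>_def by (simp add: nmul_mult nmul_sum)
  have \<phi>_\<delta>: "\<phi> (\<delta> x) = x" if "x \<in> W" for x
  proof -
    have "\<phi> (\<delta> x) = (\<Sum>w\<in>W. if w = x then x else 0)"
      unfolding \<phi>_def \<delta>_def by (rule sum.cong) auto
    then show ?thesis using that W(1) by simp
  qed
  have \<phi>_cong: "\<exists>z\<in>A. \<phi> c = \<phi> d + nmul n z" if "\<And>w. w \<in> W \<Longrightarrow> c w mod n = d w mod n" for c d
  proof -
    have "\<exists>z\<in>A. nmul (c w) w = nmul (d w) w + nmul n z" if w: "w \<in> W" for w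
    proof -
      have "nmul k w = nmul (k mod n) w + nmul n (nmul (k div n) w)" for k
        by (simp add: nmul_mult[symmetric] nmul_add_left[symmetric])
      from this[of "c w"] this[of "d w"]
      have "nmul (c w) w = nmul (d w) w + nmul n (nmul (c w div n) w - nmul (d w div n) w)"
        using \<open>\<And>w. w \<in> W \<Longrightarrow> c w mod n = d w mod n\<close>[OF w] by (simp add: nmul_diff)
      moreover have "w \<in> A" using w W(2) by blast
      then have "nmul (c w div n) w - nmul (d w div n) w \<in> A" by (intro Ad(2) Ad(5))
      ultimately show ?thesis by blast
    qed
    then have "\<forall>w\<in>W. \<exists>z. z \<in> A \<and> nmul (c w) w = nmul (d w) w + nmul n z" by blast
    from bchoice[OF this] obtain z where
      z: "\<And>w. w \<in> W \<Longrightarrow> z w \<in> A" "\<And>w. w \<in> W \<Longrightarrow> nmul (c w) w = nmul (d w) w + nmul n (z w)"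
      by blast
    have "\<phi> c = \<phi> d + nmul n (\<Sum>w\<in>W. z w)"
      unfolding \<phi>_def nmul_sum sum.distrib[symmetric] by (rule sum.cong) (simp_all add: z)
    then show ?thesis using add_subgroup_sum[OF A, of W z] z(1) by blast
  qed
  have S_cong: "\<phi> c \<in> S" if "\<phi> d \<in> S" "\<And>w. w \<in> W \<Longrightarrow> c w mod n = d w mod n" for c d
    using \<phi>_cong[of c d] that S(2) by auto
  have finV: "finite V" unfolding V_def using W(1) by (simp add: finite_PiE)
  have card_V: "card V = n ^ card W" unfolding V_def using W(1) by (simp add: card_PiE)
  have S'V: "S' \<subseteq> W \<rightarrow>\<^sub>E {..<n}" unfolding S'_def V_def by blast
  have big: "n ^ card W \<le> card F * card S'"
  proof -
    have shift: "card {c \<in> V. \<phi> c - f \<in> S} \<le> card S'" if f: "f \<in> F" for f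
    proof -
      \<comment> \<open>Adding \<open>n - 1\<close> in place \<open>f\<close> is subtraction of \<open>\<delta> f\<close> modulo \<open>n\<close> within the natural numbers.\<close>
      define g where "g c = (\<lambda>w. if w = f then (c w + (n - 1)) mod n else c w)" for c
      have fW: "f \<in> W" using f W(3) by blast
      have "g c \<in> S'" if c: "c \<in> V" "\<phi> c - f \<in> S" for c
      proof -
        have "\<phi> (\<lambda>w. c w + (n - 1) * \<delta> f w) = \<phi> c - f + nmul n f"
        proof -
          have "nmul n f = nmul (n - 1) f + f" using n by (cases n) auto
          then show ?thesis using \<phi>_\<delta>[OF fW] by (simp add: \<phi>_add \<phi>_mult)
        qed
        then have "\<phi> (\<lambda>w. c w + (n - 1) * \<delta> f w) \<in> S" using S(2)[OF c(2)] f F(2) by auto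
        then have "\<phi> (g c) \<in> S" by (rule S_cong) (auto simp: g_def \<delta>_def)
        moreover have "g c \<in> V" using c(1) n fW unfolding V_def g_def by (auto simp: PiE_iff extensional_def)
        ultimately show ?thesis unfolding S'_def by blast
      qed
      moreover have "inj_on g {c \<in> V. \<phi> c - f \<in> S}"
      proof (rule inj_onI)
        fix c d assume cd: "c \<in> {c \<in> V. \<phi> c - f \<in> S}" "d \<in> {c \<in> V. \<phi> c - f \<in> S}" "g c = g d"
        show "c = d"
        proof
          fix w
          show "c w = d w"
          proof (cases "w = f")
            case True
            have lt: "c f < n" "d f < n" using cd fW unfolding V_def by auto
            have "(c f + (n - 1)) mod n = (d f + (n - 1)) mod n" using fun_cong[OF cd(3), of f] by (simp add: g_def)
            then have "((c f + (n - 1)) + 1) mod n = ((d f + (n - 1)) + 1) mod n" by (metis mod_add_cong)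
            then show ?thesis using lt n True by simp
          next
            case False
            then show ?thesis using fun_cong[OF cd(3), of w] by (simp add: g_def)
          qed
        qed
      qed
      ultimately show ?thesis
        using finV unfolding S'_def by (intro card_inj_on_le[of g]) auto
    qed
    have "V \<subseteq> (\<Union>f\<in>F. {c \<in> V. \<phi> c - f \<in> S})" using F(3) \<phi>_A by blast
    then have "card V \<le> card (\<Union>f\<in>F. {c \<in> V. \<phi> c - f \<in> S})"
      using F(1) finV by (intro card_mono) auto
    also have "\<dots> \<le> (\<Sum>f\<in>F. card {c \<in> V. \<phi> c - f \<in> S})" by (rule card_UN_le[OF F(1)])
    also have "\<dots> \<le> card F * card S'" using sum_bounded_above[of F _ "card S'"] shift by simp
    finally show ?thesis using card_V by simp
  qed
  obtain R where R: "R \<subseteq> W \<rightarrow>\<^sub>E {..<n}" "card R \<le> 2 * (card F)\<^sup>2"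
    and Bog: "\<forall>c. (\<forall>t\<in>R. character n W t c = 1) \<longrightarrow>
       (\<exists>a\<in>S'. \<exists>b\<in>S'. \<exists>a'\<in>S'. \<exists>b'\<in>S'. \<forall>w\<in>W. int n dvd int (a w) + int (b w) - (int (a' w) + int (b' w)) - c w)"
    using Bogolyubov[OF W(1) n S'V big] by (elim exE conjE)
  define kill where "kill c \<longleftrightarrow> (\<forall>t\<in>R. character n W t (\<lambda>w. int (c w)) = 1)" for c :: "'a \<Rightarrow> nat"
  have kill_add: "kill (\<lambda>w. c w + d w)" if "kill c" "kill d" for c d
    using that unfolding kill_def by (simp add: character_add)
  have kill_mult: "kill (\<lambda>w. m * c w)" if "kill c" for m c
  proof (induction m)
    case 0 show ?case unfolding kill_def character_def by simp
  next
    case (Suc m) then show ?case using kill_add[OF that, of "\<lambda>w. m * c w"] by simp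
  qed
  \<comment> \<open>The image under \<open>\<phi>\<close> of the common kernel of the characters in \<open>R\<close>, saturated by \<open>nA\<close> because \<open>\<phi>\<close>
    is well defined only modulo \<open>nA\<close>.\<close>
  define H where "H = {x. \<exists>c z. kill c \<and> z \<in> A \<and> x = \<phi> c + nmul n z}"
  have H: "add_subgroup H"
    unfolding add_subgroup_def
  proof (intro conjI ballI)
    have "kill (\<lambda>w. 0)" unfolding kill_def character_def by simp
    moreover have "\<phi> (\<lambda>w. 0) + nmul n 0 = 0" unfolding \<phi>_def by simp
    ultimately show "0 \<in> H" unfolding H_def using Ad(1) by (metis (mono_tags, lifting) mem_Collect_eq)
  next
    fix x y assume "x \<in> H" "y \<in> H"
    then obtain c d z z' where h: "kill c" "kill d" "z \<in> A" "z' \<in> A" "x = \<phi> c + nmul n z" "y = \<phi> d + nmul n z'"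
      unfolding H_def by blast
    have "nmul n (\<phi> d) = nmul (n - 1) (\<phi> d) + \<phi> d" using n by (cases n) auto
    then have "x - y = \<phi> (\<lambda>w. c w + (n - 1) * d w) + nmul n (z - z' - \<phi> d)"
      using h by (simp add: \<phi>_add \<phi>_mult nmul_diff)
    moreover have "kill (\<lambda>w. c w + (n - 1) * d w)" using h kill_add kill_mult by blast
    moreover have "z - z' - \<phi> d \<in> A" using h Ad(2) \<phi>_A by blast
    ultimately show "x - y \<in> H" unfolding H_def by blast
  qed
  have H_sub: "H \<subseteq> {a + b - a' - b' | a b a' b'. a \<in> S \<and> b \<in> S \<and> a' \<in> S \<and> b' \<in> S}"
  proof
    fix x assume "x \<in> H"
    then obtain c z where c: "kill c" "z \<in> A" "x = \<phi> c + nmul n z" unfolding H_def by blast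
    then obtain a b a' b' where ab: "a \<in> S'" "b \<in> S'" "a' \<in> S'" "b' \<in> S'"
      and d: "\<And>w. w \<in> W \<Longrightarrow> int n dvd int (a w) + int (b w) - (int (a' w) + int (b' w)) - int (c w)"
      using Bog[rule_format, of "\<lambda>w. int (c w)"] unfolding kill_def by blast
    have "(c w + (a' w + b' w)) mod n = (a w + b w) mod n" if w: "w \<in> W" for w
    proof -
      have "int n dvd int (a w + b w) - int (c w + (a' w + b' w))" using d[OF w] by (simp add: algebra_simps)
      then have "int (a w + b w) mod int n = int (c w + (a' w + b' w)) mod int n"
        by (simp only: mod_eq_dvd_iff)
      then show ?thesis by (metis of_nat_eq_iff of_nat_mod)
    qed
    then obtain z' where z': "z' \<in> A" "\<phi> (\<lambda>w. c w + (a' w + b' w)) = \<phi> (\<lambda>w. a w + b w) + nmul n z'"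
      using \<phi>_cong[of "\<lambda>w. c w + (a' w + b' w)" "\<lambda>w. a w + b w"] by blast
    then have "\<phi> c = \<phi> a + \<phi> b + nmul n z' - \<phi> a' - \<phi> b'"
      by (simp add: \<phi>_add algebra_simps)
    then have "x = (\<phi> a + nmul n (z' + z)) + \<phi> b - \<phi> a' - \<phi> b'"
      using c(3) by (simp add: nmul_plus algebra_simps)
    moreover have "\<phi> a + nmul n (z' + z) \<in> S" using ab(1) z'(1) c(2) S(2) Ad(4) unfolding S'_def by blast
    ultimately show "x \<in> {a + b - a' - b' | a b a' b'. a \<in> S \<and> b \<in> S \<and> a' \<in> S \<and> b' \<in> S}"
      using ab unfolding S'_def by blast
  qed
  define K where "K = R \<rightarrow>\<^sub>E {..<n}"
  have finR: "finite R" using R(1) finV unfolding V_def by (rule finite_subset)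
  have "finite K" unfolding K_def using finR by (simp add: finite_PiE)
  have "card K = n ^ card R" unfolding K_def using finR by (simp add: card_PiE)
  also have "\<dots> \<le> n ^ (2 * (card F)\<^sup>2)" using R(2) n by (intro power_increasing) auto
  finally have "card K \<le> card {..<n ^ (2 * (card F)\<^sup>2)}" by simp
  then obtain enc where enc: "enc ` K \<subseteq> {..<n ^ (2 * (card F)\<^sup>2)}" "inj_on enc K"
    using card_le_inj[OF \<open>finite K\<close>, of "{..<n ^ (2 * (card F)\<^sup>2)}"] by auto
  define key where "key x = (\<lambda>t\<in>R. t x)" for x :: 'a
  have keyK: "key x \<in> K" if "x \<in> W" for x
    using that R(1) unfolding key_def K_def by (auto simp: PiE_iff subset_iff)
  define \<kappa> where "\<kappa> x = enc (key x)" for x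
  have "monochromatic_diffs \<kappa> W \<subseteq> H"
  proof
    fix u assume "u \<in> monochromatic_diffs \<kappa> W"
    then obtain x y where xy: "u = x - y" "x \<in> W" "y \<in> W" "\<kappa> x = \<kappa> y" unfolding monochromatic_diffs_def by blast
    then have key: "key x = key y" using enc(2) keyK unfolding \<kappa>_def inj_on_def by blast
    have "character n W t (\<lambda>w. int (\<delta> x w + (n - 1) * \<delta> y w)) = 1" if t: "t \<in> R" for t
    proof -
      have char_\<delta>: "character n W t (\<lambda>w. m * int (\<delta> x w)) = cis (2 * pi * real_of_int (int (t x) * m) / real n)"
        if x: "x \<in> W" for x and m :: int
      proof -
        have "character n W t (\<lambda>w. m * int (\<delta> x w)) =
          (\<Prod>w\<in>W. if w = x then cis (2 * pi * real_of_int (int (t x) * m) / real n) else 1)"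
          unfolding character_def \<delta>_def by (rule prod.cong) auto
        then show ?thesis using x W(1) by simp
      qed
      have "t x = t y" using fun_cong[OF key, of t] t by (simp add: key_def)
      moreover have "character n W t (\<lambda>w. int (\<delta> x w + (n - 1) * \<delta> y w)) =
         character n W t (\<lambda>w. 1 * int (\<delta> x w)) * character n W t (\<lambda>w. (int n - 1) * int (\<delta> y w))"
        using n by (simp add: character_add[symmetric] of_nat_diff)
      ultimately have "character n W t (\<lambda>w. int (\<delta> x w + (n - 1) * \<delta> y w)) =
          cis (2 * pi * real_of_int (int (t y) * 1) / real n + 2 * pi * real_of_int (int (t y) * (int n - 1)) / real n)"
        using char_\<delta>[OF xy(2), of 1] char_\<delta>[OF xy(3), of "int n - 1"] by (simp only: cis_mult)
      also have "2 * pi * real_of_int (int (t y) * 1) / real n + 2 * pi * real_of_int (int (t y) * (int n - 1)) / real n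
          = 2 * pi * real (t y)"
        using n by (simp add: field_simps)
      also have "cis (2 * pi * real (t y)) = 1" by (rule cis_multiple_2pi) simp
      finally show ?thesis .
    qed
    then have "kill (\<lambda>w. \<delta> x w + (n - 1) * \<delta> y w)" unfolding kill_def by blast
    moreover have "u = \<phi> (\<lambda>w. \<delta> x w + (n - 1) * \<delta> y w) + nmul n (- y)"
    proof -
      have "nmul n (- y) = - nmul n y" using nmul_diff[of n 0 y] by simp
      moreover have "nmul n y = nmul (n - 1) y + y" using n by (cases n) auto
      ultimately show ?thesis using \<phi>_\<delta> xy by (simp add: \<phi>_add \<phi>_mult)
    qed
    moreover have "- y \<in> A" using xy(3) W(2) Ad(3) by blast
    ultimately show "u \<in> H" unfolding H_def by blast
  qed
  then have "group_closure (monochromatic_diffs \<kappa> W) \<subseteq> H" by (rule group_closure_subset[OF H])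
  moreover have "\<kappa> x < n ^ (2 * (card F)\<^sup>2)" if "x \<in> W" for x
    using enc(1) keyK[OF that] unfolding \<kappa>_def by auto
  ultimately show ?thesis using H_sub by blast
qed

text \<open>
  The admissible colourings for a finite \<open>W\<close> form a closed set in the compact space of all colourings
  of \<open>A\<close>, since the condition involves finitely many coordinates. These sets have the finite
  intersection property, and a colouring in all of them is admissible for \<open>A\<close>: an element of the
  generated subgroup involves finitely many differences.
\<close>

lemma colouring_compactness:
  fixes A D :: "'a::ab_group_add set"
  assumes local: "\<And>W. finite W \<Longrightarrow> W \<subseteq> A \<Longrightarrow>
     \<exists>\<kappa> :: 'a \<Rightarrow> nat. (\<forall>x\<in>W. \<kappa> x < Q) \<and> group_closure (monochromatic_diffs \<kappa> W) \<subseteq> D"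
  shows "\<exists>\<kappa> :: 'a \<Rightarrow> nat. (\<forall>x\<in>A. \<kappa> x < Q) \<and> group_closure (monochromatic_diffs \<kappa> A) \<subseteq> D"
proof -
  let ?X = "product_topology (\<lambda>_. discrete_topology {..<Q}) A"
  define C where "C W = {\<kappa> \<in> topspace ?X. group_closure (monochromatic_diffs \<kappa> W) \<subseteq> D}" for W
  define \<C> where "\<C> = C ` {W. finite W \<and> W \<subseteq> A}"
  have mono: "monochromatic_diffs \<kappa> W \<subseteq> monochromatic_diffs \<kappa> W'" if "W \<subseteq> W'" for \<kappa> :: "'a \<Rightarrow> nat" and W W'
    using that unfolding monochromatic_diffs_def by blast
  have C_anti: "C W' \<subseteq> C W" if "W \<subseteq> W'" for W W'
    using group_closure_mono[OF mono[OF that]] unfolding C_def by blast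
  have compact: "compact_space ?X"
    by (simp add: compact_space_product_topology compact_space_discrete_topology)
  have closed: "closedin ?X (C W)" if W: "finite W" "W \<subseteq> A" for W
  proof -
    have "\<exists>U. openin ?X U \<and> \<kappa> \<in> U \<and> U \<subseteq> topspace ?X - C W" if k: "\<kappa> \<in> topspace ?X - C W" for \<kappa>
    proof -
      define U where "U = (\<Pi>\<^sub>E x\<in>A. if x \<in> W then {\<kappa> x} else {..<Q})"
      have kX: "\<kappa> \<in> A \<rightarrow>\<^sub>E {..<Q}" using k by simp
      then have kU: "\<kappa> \<in> U" unfolding U_def by (auto simp: PiE_iff)
      have "{x \<in> A. (if x \<in> W then {\<kappa> x} else {..<Q}) \<noteq> {..<Q}} \<subseteq> W" by auto
      then have "openin ?X U"
        unfolding U_def openin_PiE_gen using kX W finite_subset by (auto simp: PiE_iff)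
      moreover have "U \<subseteq> topspace ?X - C W"
      proof
        fix l assume l: "l \<in> U"
        have "l x = \<kappa> x" if "x \<in> W" for x
          using PiE_mem[OF l[unfolded U_def], of x] that W(2) by auto
        then have "monochromatic_diffs l W = monochromatic_diffs \<kappa> W" by (rule monochromatic_diffs_cong)
        moreover have "l \<in> topspace ?X"
          using openin_subset[OF \<open>openin ?X U\<close>] l by blast
        ultimately show "l \<in> topspace ?X - C W" using k unfolding C_def by simp
      qed
      ultimately show ?thesis using kU by blast
    qed
    then have "openin ?X (topspace ?X - C W)" using openin_subopen[of ?X "topspace ?X - C W"] by blast
    moreover have "C W \<subseteq> topspace ?X" unfolding C_def by blast
    ultimately show ?thesis unfolding closedin_def by blast
  qed
  have nonempty: "\<Inter>\<F> \<noteq> {}" if \<F>: "finite \<F>" "\<F> \<subseteq> \<C>" for \<F>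
  proof -
    obtain \<W> where \<W>: "finite \<W>" "\<W> \<subseteq> {W. finite W \<and> W \<subseteq> A}" "\<F> = C ` \<W>"
      using finite_subset_image[OF \<F>[unfolded \<C>_def]] by blast
    let ?W = "\<Union>\<W>"
    have W: "finite ?W" "?W \<subseteq> A" using \<W>(1,2) by auto
    then obtain \<kappa> where k: "\<forall>x\<in>?W. \<kappa> x < Q" "group_closure (monochromatic_diffs \<kappa> ?W) \<subseteq> D"
      using local by blast
    have Q: "0 < Q" if "x \<in> A" for x
      using local[of "{x}"] that by auto
    define \<kappa>' where "\<kappa>' = (\<lambda>x\<in>A. if x \<in> ?W then \<kappa> x else 0)"
    have "monochromatic_diffs \<kappa>' ?W = monochromatic_diffs \<kappa> ?W"
    proof -
      have "\<kappa>' x = \<kappa> x" if "x \<in> ?W" for x using that W(2) unfolding \<kappa>'_def by auto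
      then show ?thesis by (rule monochromatic_diffs_cong)
    qed
    moreover have "\<kappa>' \<in> topspace ?X" unfolding \<kappa>'_def using k(1) Q by auto
    ultimately have "\<kappa>' \<in> C ?W" using k(2) unfolding C_def by simp
    then have "\<kappa>' \<in> C W" if "W \<in> \<W>" for W using C_anti[of W ?W] that by blast
    then show ?thesis unfolding \<W>(3) by blast
  qed
  have "\<Inter>\<C> \<noteq> {}"
  proof -
    have "\<forall>C\<in>\<C>. closedin ?X C" using closed unfolding \<C>_def by blast
    then show ?thesis using compact[unfolded compact_space_fip] nonempty by blast
  qed
  then obtain \<kappa> where \<kappa>: "\<And>W. finite W \<Longrightarrow> W \<subseteq> A \<Longrightarrow> \<kappa> \<in> C W" unfolding \<C>_def by blast
  have "\<exists>W. finite W \<and> W \<subseteq> A \<and> u \<in> group_closure (monochromatic_diffs \<kappa> W)"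
    if "u \<in> group_closure (monochromatic_diffs \<kappa> A)" for u
    using that
  proof induction
    case (base s)
    then consider "s = 0" | x y where "s = x - y" "x \<in> A" "y \<in> A" "\<kappa> x = \<kappa> y"
      unfolding monochromatic_diffs_def by blast
    then show ?case
    proof cases
      case 1
      then show ?thesis by (intro exI[of _ "{}"]) simp
    next
      case 2
      then have "s \<in> monochromatic_diffs \<kappa> {x, y}" unfolding monochromatic_diffs_def by blast
      then have "s \<in> group_closure (monochromatic_diffs \<kappa> {x, y})" by (intro group_closure.base) simp
      then show ?thesis using 2 by (intro exI[of _ "{x, y}"]) simp
    qed
  next
    case (diff s t)
    then obtain W W' where W: "finite W" "W \<subseteq> A" "s \<in> group_closure (monochromatic_diffs \<kappa> W)"
      "finite W'" "W' \<subseteq> A" "t \<in> group_closure (monochromatic_diffs \<kappa> W')" by blast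
    then have "s - t \<in> group_closure (monochromatic_diffs \<kappa> (W \<union> W'))"
      using group_closure_mono[OF mono[of W "W \<union> W'" \<kappa>]] group_closure_mono[OF mono[of W' "W \<union> W'" \<kappa>]]
      by (intro group_closure.diff) auto
    then show ?case using W by (intro exI[of _ "W \<union> W'"]) simp
  qed
  then have "group_closure (monochromatic_diffs \<kappa> A) \<subseteq> D" using \<kappa> unfolding C_def by blast
  moreover have "\<kappa> x < Q" if "x \<in> A" for x
    using \<kappa>[of "{}"] that unfolding C_def by (auto simp: PiE_iff)
  ultimately show ?thesis by blast
qed

theorem Bogolyubov_subgroup:
  fixes A S F :: "'a::ab_group_add set"
  assumes A: "add_subgroup A" and n: "n \<ge> 1"
    and S: "S \<subseteq> A" "\<And>x z. x \<in> S \<Longrightarrow> z \<in> A \<Longrightarrow> x + nmul n z \<in> S"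
    and F: "finite F" "F \<subseteq> A" "\<And>x. x \<in> A \<Longrightarrow> \<exists>f\<in>F. x - f \<in> S"
  obtains H I where "add_subgroup H" "H \<subseteq> A"
    "H \<subseteq> {a + b - a' - b' | a b a' b'. a \<in> S \<and> b \<in> S \<and> a' \<in> S \<and> b' \<in> S}"
    "finite I" "I \<subseteq> A" "\<And>x. x \<in> A \<Longrightarrow> \<exists>i\<in>I. x - i \<in> H"
proof -
  let ?D = "{a + b - a' - b' | a b a' b'. a \<in> S \<and> b \<in> S \<and> a' \<in> S \<and> b' \<in> S}"
  let ?Q = "n ^ (2 * (card F)\<^sup>2)"
  have "\<exists>\<kappa> :: 'a \<Rightarrow> nat. (\<forall>x\<in>W. \<kappa> x < ?Q) \<and> group_closure (monochromatic_diffs \<kappa> W) \<subseteq> ?D"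
    if W: "finite W" "W \<subseteq> A" for W
  proof -
    obtain \<kappa> :: "'a \<Rightarrow> nat" where k: "\<forall>x\<in>W \<union> F. \<kappa> x < ?Q" "group_closure (monochromatic_diffs \<kappa> (W \<union> F)) \<subseteq> ?D"
      using colouring_finite[OF A n S F, of "W \<union> F"] W F(1,2) by auto
    have "monochromatic_diffs \<kappa> W \<subseteq> monochromatic_diffs \<kappa> (W \<union> F)" unfolding monochromatic_diffs_def by blast
    then have "group_closure (monochromatic_diffs \<kappa> W) \<subseteq> ?D" using group_closure_mono k(2) by blast
    then show ?thesis using k(1) by blast
  qed
  from colouring_compactness[OF this] obtain \<kappa> :: "'a \<Rightarrow> nat"
    where k: "\<forall>x\<in>A. \<kappa> x < ?Q" "group_closure (monochromatic_diffs \<kappa> A) \<subseteq> ?D" by blast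
  define rep where "rep = inv_into A \<kappa>"
  have rep: "rep (\<kappa> x) \<in> A" "\<kappa> (rep (\<kappa> x)) = \<kappa> x" if "x \<in> A" for x
    using that unfolding rep_def by (auto intro: inv_into_into f_inv_into_f)
  show ?thesis
  proof (rule that)
    show "add_subgroup (group_closure (monochromatic_diffs \<kappa> A))" by (rule add_subgroup_group_closure)
    show "group_closure (monochromatic_diffs \<kappa> A) \<subseteq> A"
      by (rule group_closure_subset[OF A]) (use add_subgroupD(2)[OF A] in \<open>auto simp: monochromatic_diffs_def\<close>)
    have "\<kappa> ` A \<subseteq> {..<?Q}" using k(1) by blast
    then have "finite (\<kappa> ` A)" by (rule finite_subset) simp
    then show "finite (rep ` \<kappa> ` A)" by blast
    show "rep ` \<kappa> ` A \<subseteq> A" using rep by blast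
    fix x assume x: "x \<in> A"
    then have "x - rep (\<kappa> x) \<in> monochromatic_diffs \<kappa> A" using rep[OF x] unfolding monochromatic_diffs_def by force
    then show "\<exists>i\<in>rep ` \<kappa> ` A. x - i \<in> group_closure (monochromatic_diffs \<kappa> A)"
      using x by (intro bexI[of _ "rep (\<kappa> x)"] group_closure.base) auto
  qed (rule k(2))
qed

section \<open>Open subgroups of compact abelian groups\<close>

lemma add_subgroup_closure:
  fixes H :: "'a::topological_ab_group_add set"
  assumes "add_subgroup H" shows "add_subgroup (closure H)"
proof -
  have "(\<lambda>p. fst p - snd p) ` closure (H \<times> H) \<subseteq> closure H"
  proof (rule image_closure_subset)
    show "continuous_on (closure (H \<times> H)) (\<lambda>p. fst p - snd p)" by (intro continuous_intros)
    show "(\<lambda>p. fst p - snd p) ` (H \<times> H) \<subseteq> closure H"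
      using add_subgroupD(2)[OF assms] closure_subset[of H] by auto
  qed simp
  then have "x - y \<in> closure H" if "x \<in> closure H" "y \<in> closure H" for x y
    using that unfolding closure_Times by force
  moreover have "0 \<in> closure H" using add_subgroupD(1)[OF assms] closure_subset by blast
  ultimately show ?thesis unfolding add_subgroup_def by blast
qed

lemma continuous_on_nmul [continuous_intros]:
  "continuous_on S f \<Longrightarrow> continuous_on S (\<lambda>x. nmul n (f x :: 'a::topological_comm_monoid_add))"
  unfolding nmul_def by (intro continuous_intros)

text \<open>
  Apply Bogolyubov's lemma to the points of \<open>A\<close> within a small neighbourhood \<open>E\<close> of \<open>nA\<close>. The
  resulting subgroup \<open>H\<close> lies in \<open>4 E + nA\<close>, and \<open>E\<close> is chosen so small that even \<open>5 E + nA\<close> misses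
  \<open>y\<close>; thus \<open>y\<close> is not in the closure of \<open>H\<close>. This closure is a closed subgroup of finite index in
  \<open>A\<close>, hence its complement in \<open>A\<close> is a finite union of closed cosets and it is relatively open.
\<close>

theorem separating_subgroup:
  fixes A :: "'a::{topological_ab_group_add, t2_space} set"
  assumes comp: "compact (UNIV :: 'a set)" and A: "closed A" "add_subgroup A"
    and n: "n \<ge> 1" and y: "y \<in> A" "y \<notin> nmul n ` A"
  obtains H U where "add_subgroup H" "H \<subseteq> A" "y \<notin> H" "open U" "0 \<in> U" "U \<inter> A \<subseteq> H"
proof -
  note Ad = add_subgroupD[OF A(2)]
  have cA: "compact A" using compact_Int_closed[OF comp A(1)] by simp
  have "compact (nmul n ` A)" by (intro compact_continuous_image cA continuous_intros)
  then have cZ: "closed (nmul n ` A)" by (rule compact_imp_closed)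
  define U0 where "U0 = - ((\<lambda>u. y - u) -` (nmul n ` A))"
  have "closed ((\<lambda>u. y - u) -` (nmul n ` A))" by (rule closed_vimage[OF cZ]) (intro continuous_intros)
  then have "open U0" "0 \<in> U0" using y unfolding U0_def by auto
  then obtain N1 where N1: "sym_nbhd N1" "\<And>a b. a \<in> N1 \<Longrightarrow> b \<in> N1 \<Longrightarrow> a + b \<in> U0"
    using halve_nbhd[of U0] by blast
  obtain N2 where N2: "sym_nbhd N2" "\<And>a b. a \<in> N2 \<Longrightarrow> b \<in> N2 \<Longrightarrow> a + b \<in> N1"
    using halve_nbhd[of N1] N1(1) unfolding sym_nbhd_def by blast
  obtain E where E: "sym_nbhd E" "\<And>a b. a \<in> E \<Longrightarrow> b \<in> E \<Longrightarrow> a + b \<in> N2"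
    using halve_nbhd[of N2] N2(1) unfolding sym_nbhd_def by blast
  have E0: "0 \<in> E" and Em: "\<And>e. e \<in> E \<Longrightarrow> - e \<in> E" and Eo: "open E"
    using E(1) unfolding sym_nbhd_def by auto
  define S where "S = {x \<in> A. \<exists>z\<in>A. x - nmul n z \<in> E}"
  have S1: "S \<subseteq> A" unfolding S_def by blast
  have S2: "x + nmul n z \<in> S" if "x \<in> S" "z \<in> A" for x z
  proof -
    obtain w where w: "w \<in> A" "x - nmul n w \<in> E" "x \<in> A" using \<open>x \<in> S\<close> unfolding S_def by blast
    have "x + nmul n z - nmul n (w + z) \<in> E" using w(2) by (simp add: nmul_plus)
    moreover have "x + nmul n z \<in> A" "w + z \<in> A" using w that Ad(4,5) by blast+
    ultimately show ?thesis unfolding S_def by blast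
  qed
  obtain F where F: "F \<subseteq> A" "finite F" "A \<subseteq> (\<Union>f\<in>F. {x. x - f \<in> E})"
  proof (rule compactE_image[OF cA, of A "\<lambda>f. {x. x - f \<in> E}"])
    show "open {x. x - f \<in> E}" for f using open_translate(1)[OF Eo] .
    show "A \<subseteq> (\<Union>f\<in>A. {x. x - f \<in> E})" using E0 by auto
  qed
  have F3: "\<exists>f\<in>F. x - f \<in> S" if x: "x \<in> A" for x
  proof -
    obtain f where f: "f \<in> F" "x - f \<in> E" using F(3) x by blast
    have "x - f \<in> A" using f(1) x F(1) Ad(2) by blast
    moreover have "x - f - nmul n 0 \<in> E" using f(2) by simp
    ultimately have "x - f \<in> S" using Ad(1) unfolding S_def by blast
    then show ?thesis using f(1) by blast
  qed
  obtain H I where H: "add_subgroup H" "H \<subseteq> A"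
    "H \<subseteq> {a + b - a' - b' | a b a' b'. a \<in> S \<and> b \<in> S \<and> a' \<in> S \<and> b' \<in> S}"
    and I: "finite I" "I \<subseteq> A" "\<And>x. x \<in> A \<Longrightarrow> \<exists>i\<in>I. x - i \<in> H"
    using Bogolyubov_subgroup[OF A(2) n S1 S2 F(2,1) F3] by blast
  let ?H = "closure H"
  have cH: "add_subgroup ?H" by (rule add_subgroup_closure[OF H(1)])
  have HA: "?H \<subseteq> A" using H(2) A(1) by (rule closure_minimal)
  have yH: "y \<notin> ?H"
  proof
    assume "y \<in> ?H"
    moreover have "open {x. x - y \<in> E}" "y \<in> {x. x - y \<in> E}" using open_translate(1)[OF Eo] E0 by auto
    ultimately obtain d where d: "d \<in> H" "d - y \<in> E"
      unfolding closure_iff_nhds_not_empty by blast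
    then obtain a b a' b' where ab: "d = a + b - a' - b'" "a \<in> S" "b \<in> S" "a' \<in> S" "b' \<in> S"
      using H(3) by blast
    obtain za where za: "za \<in> A" "a - nmul n za \<in> E" using ab(2) unfolding S_def by blast
    obtain zb where zb: "zb \<in> A" "b - nmul n zb \<in> E" using ab(3) unfolding S_def by blast
    obtain za' where za': "za' \<in> A" "a' - nmul n za' \<in> E" using ab(4) unfolding S_def by blast
    obtain zb' where zb': "zb' \<in> A" "b' - nmul n zb' \<in> E" using ab(5) unfolding S_def by blast
    let ?z = "za + zb - za' - zb'"
    have "(a - nmul n za) + (b - nmul n zb) \<in> N2" using E(2) za zb by blast
    moreover have "- (a' - nmul n za') + - (b' - nmul n zb') \<in> N2" using E(2) Em za' zb' by blast
    ultimately have "((a - nmul n za) + (b - nmul n zb)) + (- (a' - nmul n za') + - (b' - nmul n zb')) \<in> N1"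
      by (rule N2(2))
    moreover have "- (d - y) \<in> N1"
    proof -
      have "- (d - y) + 0 \<in> N2" using E(2) Em E0 d(2) by blast
      moreover have "0 \<in> N2" using N2(1) unfolding sym_nbhd_def by blast
      ultimately show ?thesis using N2(2)[of "- (d - y)" 0] by simp
    qed
    ultimately have u: "((a - nmul n za) + (b - nmul n zb)) + (- (a' - nmul n za') + - (b' - nmul n zb'))
        + - (d - y) \<in> U0" (is "?u \<in> U0") by (rule N1(2))
    have "y - ?u = nmul n ?z" unfolding ab(1) by (simp add: nmul_plus nmul_diff algebra_simps)
    moreover have "?z \<in> A" by (intro Ad(2) Ad(4) za(1) zb(1) za'(1) zb'(1))
    ultimately have "y - ?u \<in> nmul n ` A" by blast
    then show False using u unfolding U0_def by blast
  qed
  define B where "B = (\<Union>i\<in>{i \<in> I. i \<notin> ?H}. {x. x - i \<in> ?H})"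
  have "closed {x. x - i \<in> ?H}" for i
  proof -
    have "closed ((\<lambda>x. x - i) -` ?H)" by (rule closed_vimage[OF closed_closure]) (intro continuous_intros)
    then show ?thesis by (simp add: vimage_def)
  qed
  then have "closed B" unfolding B_def using I(1) by (intro closed_UN) auto
  then have "open (- B)" by blast
  moreover have "0 \<in> - B"
  proof -
    have "0 - i \<notin> ?H" if "i \<notin> ?H" for i using add_subgroupD(3)[OF cH, of "- i"] that by auto
    then show ?thesis unfolding B_def by blast
  qed
  moreover have "- B \<inter> A \<subseteq> ?H"
  proof
    fix x assume x: "x \<in> - B \<inter> A"
    then obtain i where i: "i \<in> I" "x - i \<in> ?H" using I(3) closure_subset by blast
    then have "i \<in> ?H" using x unfolding B_def by blast
    then show "x \<in> ?H" using add_subgroupD(4)[OF cH i(2), of i] by simp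
  qed
  ultimately show ?thesis using that[OF cH HA yH] by blast
qed

text \<open>
  A point outside \<open>nG\<close> would be avoided by an open subgroup of \<open>G\<close>, but a connected group has no proper
  open subgroup.
\<close>

theorem compact_connected_divisible:
  fixes y :: "'a::{topological_ab_group_add, t2_space}"
  assumes comp: "compact (UNIV :: 'a set)" and conn: "connected (UNIV :: 'a set)" and n: "n \<ge> 1"
  shows "\<exists>x. nmul n x = y"
proof (rule ccontr)
  assume "\<not> ?thesis"
  then have "y \<notin> nmul n ` (UNIV :: 'a set)" by auto
  moreover have "add_subgroup (UNIV :: 'a set)" by (simp add: add_subgroup_def)
  ultimately obtain H U where H: "add_subgroup H" "y \<notin> H" and U: "open U" "0 \<in> U" "U \<inter> UNIV \<subseteq> H"
    using separating_subgroup[OF comp closed_UNIV _ n UNIV_I, of y] by metis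
  have nb: "open {z. z - x \<in> U}" "x \<in> {z. z - x \<in> U}" for x
    using open_translate(1)[OF U(1)] U(2) by auto
  have "\<exists>V. open V \<and> x \<in> V \<and> V \<subseteq> H" if x: "x \<in> H" for x
  proof -
    have "{z. z - x \<in> U} \<subseteq> H"
    proof
      fix z assume "z \<in> {z. z - x \<in> U}"
      then have "z - x \<in> H" using U(3) by blast
      then show "z \<in> H" using add_subgroupD(4)[OF H(1) _ x, of "z - x"] by simp
    qed
    then show ?thesis using nb by blast
  qed
  then have "open H" using open_subopen[of H] by blast
  have "\<exists>V. open V \<and> x \<in> V \<and> V \<subseteq> - H" if x: "x \<in> - H" for x
  proof -
    have "{z. z - x \<in> U} \<subseteq> - H"
    proof
      fix z assume "z \<in> {z. z - x \<in> U}"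
      then have "z - x \<in> H" using U(3) by blast
      then show "z \<in> - H" using add_subgroupD(2)[OF H(1), of z "z - x"] x by auto
    qed
    then show ?thesis using nb by blast
  qed
  then have "open (- H)" using open_subopen[of "- H"] by blast
  then show False
    using connectedD[OF conn \<open>open H\<close>, of "- H"] H(2) add_subgroupD(1)[OF H(1)] by blast
qed

text \<open>
  In the vector space \<open>K = {x. q x = 0}\<close> over the field with \<open>q\<close> elements, a subspace \<open>M\<close> that is maximal
  among those that contain \<open>H\<close> and avoid \<open>y\<close> is a hyperplane complementary to the line spanned by
  \<open>y\<close>.
\<close>

lemma torsion_index_subgroup:
  fixes H :: "'a::ab_group_add set"
  assumes q: "prime q" and H: "add_subgroup H" "H \<subseteq> {x. nmul q x = 0}"
    and y: "nmul q y = 0" "y \<notin> H"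
  obtains M where "add_subgroup M" "H \<subseteq> M" "M \<subseteq> {x. nmul q x = 0}"
    "\<And>x. nmul q x = 0 \<Longrightarrow> \<exists>j<q. x - nmul j y \<in> M"
    "\<And>i j. i < q \<Longrightarrow> j < q \<Longrightarrow> nmul i y - nmul j y \<in> M \<Longrightarrow> i = j"
proof -
  define K where "K = {x :: 'a. nmul q x = 0}"
  have q1: "q > 1" using q prime_gt_1_nat by blast
  define \<A> where "\<A> = {M. add_subgroup M \<and> H \<subseteq> M \<and> M \<subseteq> K \<and> y \<notin> M}"
  have "\<exists>M\<in>\<A>. \<forall>X\<in>\<A>. M \<subseteq> X \<longrightarrow> X = M"
  proof (rule subset_Zorn_nonempty)
    show "\<A> \<noteq> {}" using H y unfolding \<A>_def K_def by blast
    fix \<C> assume C: "\<C> \<noteq> {}" "subset.chain \<A> \<C>"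
    then have CA: "\<C> \<subseteq> \<A>" and lin: "\<And>X Y. X \<in> \<C> \<Longrightarrow> Y \<in> \<C> \<Longrightarrow> X \<subseteq> Y \<or> Y \<subseteq> X"
      unfolding subset_chain_def by auto
    have sub: "add_subgroup X" if "X \<in> \<C>" for X using that CA unfolding \<A>_def by blast
    obtain X0 where X0: "X0 \<in> \<C>" using C(1) by blast
    have "add_subgroup (\<Union>\<C>)"
      unfolding add_subgroup_def
    proof (intro conjI ballI)
      show "0 \<in> \<Union>\<C>" using X0 add_subgroupD(1)[OF sub[OF X0]] by blast
      fix a b assume "a \<in> \<Union>\<C>" "b \<in> \<Union>\<C>"
      then obtain X Y where XY: "X \<in> \<C>" "a \<in> X" "Y \<in> \<C>" "b \<in> Y" by blast
      then obtain Z where "Z \<in> \<C>" "a \<in> Z" "b \<in> Z" using lin[of X Y] by blast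
      then show "a - b \<in> \<Union>\<C>" using add_subgroupD(2)[OF sub] by blast
    qed
    moreover have "H \<subseteq> \<Union>\<C>" using X0 CA unfolding \<A>_def by blast
    moreover have "\<Union>\<C> \<subseteq> K" "y \<notin> \<Union>\<C>" using CA unfolding \<A>_def by blast+
    ultimately show "\<Union>\<C> \<in> \<A>" unfolding \<A>_def by blast
  qed
  then obtain M where "M \<in> \<A>" and max: "\<forall>X\<in>\<A>. M \<subseteq> X \<longrightarrow> X = M" by (elim bexE)
  then have M: "add_subgroup M" "H \<subseteq> M" "M \<subseteq> K" "y \<notin> M" unfolding \<A>_def by auto
  note Md = add_subgroupD[OF M(1)]
  have inverse: "\<exists>i. \<forall>x\<in>K. nmul i (nmul j x) = x" if j: "\<not> q dvd j" for j
  proof -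
    have "coprime j q" using q j by (metis coprime_commute prime_imp_coprime)
    then obtain i where i: "[j * i = 1] (mod q)" using cong_solve_coprime_nat[of j q] by auto
    have "nmul i (nmul j x) = x" if x: "x \<in> K" for x
    proof -
      have red: "nmul k x = nmul (k mod q) x" for k
      proof -
        have "nmul k x = nmul (k div q * q) x + nmul (k mod q) x" by (simp flip: nmul_add_left)
        also have "nmul (k div q * q) x = 0" using x unfolding nmul_mult K_def by simp
        finally show ?thesis by simp
      qed
      have "nmul i (nmul j x) = nmul (i * j) x" by (simp add: nmul_mult)
      also have "\<dots> = nmul 1 x" using i red[of "i * j"] red[of 1] unfolding cong_def by (simp add: mult.commute)
      finally show ?thesis by simp
    qed
    then show ?thesis by blast
  qed
  have yK: "y \<in> K" using y(1) unfolding K_def by simp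
  have multiple: "q dvd j" if j: "nmul j y \<in> M" for j
  proof (rule ccontr)
    assume "\<not> q dvd j"
    then obtain i where "nmul i (nmul j y) = y" using inverse yK by blast
    then have "y \<in> M" using Md(5)[OF j, of i] by simp
    then show False using M(4) by simp
  qed
  have neg: "- nmul j x = nmul ((q - 1) * j) x" if "x \<in> K" for j x
  proof -
    have "nmul ((q - 1) * j) x + nmul j x = nmul (q * j) x"
      using q1 by (simp flip: nmul_add_left add: algebra_simps)
    also have "\<dots> = 0" using that unfolding K_def by (simp add: mult.commute[of q] nmul_mult)
    finally show ?thesis by (intro minus_unique) (simp only: add.commute)
  qed
  have cover: "\<exists>j. x - nmul j y \<in> M" if x: "x \<in> K" for x
  proof (cases "x \<in> M")
    case True
    then show ?thesis by (intro exI[of _ 0]) simp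
  next
    case False
    define X where "X = {m + nmul j x | m j. m \<in> M}"
    have "add_subgroup X"
      unfolding add_subgroup_def
    proof (intro conjI ballI)
      have "0 = 0 + nmul 0 x" by simp
      then show "0 \<in> X" unfolding X_def using Md(1) by blast
      fix a b assume "a \<in> X" "b \<in> X"
      then obtain m j m' j' where m: "a = m + nmul j x" "b = m' + nmul j' x" "m \<in> M" "m' \<in> M"
        unfolding X_def by blast
      have "a - b = (m - m') + (nmul j x + - nmul j' x)" using m by simp
      also have "\<dots> = (m - m') + nmul (j + (q - 1) * j') x" using neg[OF x] by (simp add: nmul_add_left)
      finally show "a - b \<in> X" unfolding X_def using Md(2) m by blast
    qed
    moreover have MX: "M \<subseteq> X"
    proof
      fix m assume "m \<in> M"
      moreover have "m = m + nmul 0 x" by simp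
      ultimately show "m \<in> X" unfolding X_def by blast
    qed
    moreover have "x \<in> X"
    proof -
      have "x = 0 + nmul 1 x" by simp
      then show ?thesis unfolding X_def using Md(1) by blast
    qed
    moreover have "X \<subseteq> K"
    proof
      fix u assume "u \<in> X"
      then obtain m j where "u = m + nmul j x" "m \<in> M" unfolding X_def by blast
      moreover have "nmul q (nmul j x) = 0"
        using x unfolding K_def by (metis (mono_tags) mem_Collect_eq mult.commute nmul_mult nmul_simps(3))
      ultimately show "u \<in> K" using M(3) unfolding K_def by (auto simp: nmul_plus)
    qed
    ultimately have "y \<in> X" using bspec[OF max, of X] M(2) False unfolding \<A>_def by auto
    then obtain m j where mj: "y = m + nmul j x" "m \<in> M" unfolding X_def by blast
    have "\<not> q dvd j"
    proof
      assume "q dvd j"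
      then obtain i where "j = i * q" by (metis dvd_def mult.commute)
      then have "nmul j x = 0" using x by (simp add: nmul_mult K_def)
      then show False using mj M(4) by simp
    qed
    then obtain i where "nmul i (nmul j x) = x" using inverse x by blast
    then have "nmul i y = nmul i m + x" using mj(1) by (simp add: nmul_plus)
    then have "x - nmul i y = - nmul i m" by simp
    also have "\<dots> \<in> M" using Md(3,5) mj(2) by blast
    finally show ?thesis by blast
  qed
  show ?thesis
  proof (rule that[OF M(1,2)])
    show "M \<subseteq> {x. nmul q x = 0}" using M(3) unfolding K_def .
    fix x :: 'a assume "nmul q x = 0"
    then obtain j where j: "x - nmul j y \<in> M" using cover unfolding K_def by blast
    have "nmul j y = nmul (j div q * q) y + nmul (j mod q) y" by (simp flip: nmul_add_left)
    also have "nmul (j div q * q) y = 0" using y(1) by (simp add: nmul_mult)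
    finally have "x - nmul (j mod q) y \<in> M" using j by simp
    then show "\<exists>j<q. x - nmul j y \<in> M" using q1 by (intro exI[of _ "j mod q"]) simp
  next
    have le: "i = j" if ij: "i \<le> j" "j < q" "nmul j y - nmul i y \<in> M" for i j
    proof -
      have "nmul j y = nmul (j - i) y + nmul i y" using ij(1) by (simp flip: nmul_add_left)
      then have "nmul (j - i) y \<in> M" using ij(3) by simp
      then have "q dvd (j - i)" by (rule multiple)
      then show ?thesis using ij by (auto dest: dvd_imp_le)
    qed
    fix i j assume ij: "i < q" "j < q" "nmul i y - nmul j y \<in> M"
    then have "nmul j y - nmul i y \<in> M" using Md(3)[of "nmul i y - nmul j y"] by simp
    then show "i = j" using le[of i j] le[of j i] ij by linarith
  qed
qed

section \<open>A connected covering from a torsion element\<close>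

text \<open>
  Multiplication by \<open>n\<close> is onto and, by compactness, closed; the \<open>n\<close>-saturation \<open>C\<close> of an open set is a
  union of its translates, so the complement of the image is the image of a closed set.
\<close>

lemma open_map_nmul:
  fixes B :: "'a::{topological_ab_group_add, t2_space} set"
  assumes comp: "compact (UNIV :: 'a set)" and conn: "connected (UNIV :: 'a set)" and n: "n \<ge> 1"
    and B: "open B"
  shows "open (nmul n ` B)"
proof -
  define K where "K = {u :: 'a. nmul n u = 0}"
  define C where "C = (\<Union>u\<in>K. {x. x - u \<in> B})"
  have eq: "x \<in> C \<longleftrightarrow> nmul n x \<in> nmul n ` B" for x
  proof
    assume "x \<in> C"
    then obtain u where u: "nmul n u = 0" "x - u \<in> B" unfolding C_def K_def by blast
    then have "nmul n x = nmul n (x - u)" by (simp add: nmul_diff)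
    then show "nmul n x \<in> nmul n ` B" using u(2) by blast
  next
    assume "nmul n x \<in> nmul n ` B"
    then obtain b where b: "b \<in> B" "nmul n x = nmul n b" by blast
    then have "x - b \<in> K" "x - (x - b) \<in> B" unfolding K_def by (simp_all add: nmul_diff)
    then show "x \<in> C" unfolding C_def by blast
  qed
  have "open C" unfolding C_def using open_translate(1)[OF B] by blast
  then have "compact (- C)" using compact_Int_closed[OF comp, of "- C"] by (simp add: closed_Compl)
  then have "compact (nmul n ` (- C))" by (intro compact_continuous_image continuous_intros)
  then have "closed (nmul n ` (- C))" by (rule compact_imp_closed)
  moreover have "nmul n ` B = - (nmul n ` (- C))"
  proof (intro equalityI subsetI)
    fix z assume z: "z \<in> nmul n ` B"
    have "x \<in> C" if "z = nmul n x" for x using eq[of x] z that by simp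
    then show "z \<in> - (nmul n ` (- C))" by blast
  next
    fix z assume z: "z \<in> - (nmul n ` (- C))"
    obtain x where x: "nmul n x = z" using compact_connected_divisible[OF comp conn n] by blast
    then have "x \<in> C" using z by blast
    then show "z \<in> nmul n ` B" using eq[of x] x by simp
  qed
  ultimately show ?thesis by (simp add: open_Compl)
qed

lemma fold_covering_Hausdorff:
  fixes p :: "'b \<Rightarrow> 'a::t2_space"
  assumes "fold_covering_map k X euclidean p"
  shows "Hausdorff_space X"
  unfolding Hausdorff_space_def
proof (intro allI impI, elim conjE)
  fix a b assume ab: "a \<in> topspace X" "b \<in> topspace X" "a \<noteq> b"
  have cont: "continuous_map X euclidean p" using assms unfolding fold_covering_map_def by blast
  show "\<exists>U V. openin X U \<and> openin X V \<and> a \<in> U \<and> b \<in> V \<and> disjnt U V"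
  proof (cases "p a = p b")
    case False
    then obtain U V where UV: "open U" "open V" "p a \<in> U" "p b \<in> V" "U \<inter> V = {}"
      using hausdorff by metis
    then have "openin X {x \<in> topspace X. p x \<in> U}" "openin X {x \<in> topspace X. p x \<in> V}"
      using openin_continuous_map_preimage[OF cont] by auto
    then show ?thesis using UV ab
      by (intro exI[of _ "{x \<in> topspace X. p x \<in> U}"] exI[of _ "{x \<in> topspace X. p x \<in> V}"])
        (auto simp: disjnt_iff)
  next
    case True
    obtain W V where W: "open W" "p a \<in> W"
      and V: "{x \<in> topspace X. p x \<in> W} = (\<Union>i\<in>{1..k}. V i)"
        "disjoint_family_on V {1..k}" "\<forall>i\<in>{1..k}. sheet X p (V i) W"
      using fold_covering_sheets[OF assms, of "p a"] by metis
    have "a \<in> (\<Union>i\<in>{1..k}. V i)" "b \<in> (\<Union>i\<in>{1..k}. V i)"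
      unfolding V(1)[symmetric] using ab W(2) True by auto
    then obtain i j where ij: "i \<in> {1..k}" "a \<in> V i" "j \<in> {1..k}" "b \<in> V j" by blast
    have "i \<noteq> j" using sheetD(3)[OF bspec[OF V(3) ij(1)]] ij True ab(3) unfolding inj_on_def by blast
    then have "disjnt (V i) (V j)" using V(2) ij unfolding disjoint_family_on_def disjnt_def by blast
    then show ?thesis using V(3) ij unfolding sheet_def by blast
  qed
qed

text \<open>
  The set \<open>UNIV \<times> {..<q}\<close> serves as a model of \<open>G/M\<close>: for a choice \<open>s\<close> of preimages under multiplication
  by \<open>q\<close>, the coset of \<open>x\<close> corresponds to \<open>(q x, j)\<close>, where \<open>x\<close> lies in \<open>s(q x) + j y + M\<close>. The map
  \<open>\<theta>\<close> that realises this has the \<open>M\<close>-cosets as fibres and induces the quotient topology. The points with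
  second component in \<open>{q..<k}\<close> form \<open>k - q\<close> separate copies of \<open>G\<close>, and the covering map is the first
  projection. In a trivial covering, a sheet that meets the connected image of \<open>\<theta>\<close> contains all of it;
  but \<open>\<theta> 0\<close> and \<open>\<theta> y\<close> are distinct points over \<open>0\<close>.
\<close>

theorem coverings_trivial_imp_torsion_free:
  fixes y :: "'a::{topological_ab_group_add, t2_space}"
  assumes comp: "compact (UNIV :: 'a set)" and conn: "connected (UNIV :: 'a set)"
    and triv: "all_fold_coverings_trivial TYPE('a \<times> nat) k (euclidean :: 'a topology)"
    and q: "prime q" "q \<le> k" and y: "nmul q y = 0"
  shows "y = 0"
proof (rule ccontr)
  assume y0: "y \<noteq> 0"
  define K where "K = {x :: 'a. nmul q x = 0}"
  have q1: "q > 1" using q(1) prime_gt_1_nat by blast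
  then have q1': "q \<ge> 1" by simp
  have "closed (nmul q -` {0 :: 'a})"
    by (rule closed_vimage) (auto intro: continuous_intros)
  then have K: "closed K" "add_subgroup K"
    unfolding K_def add_subgroup_def by (simp_all add: vimage_def nmul_diff)
  have "nmul q ` K \<subseteq> {0}" unfolding K_def by auto
  then have "y \<in> K" "y \<notin> nmul q ` K" using y y0 unfolding K_def by auto
  then obtain H U where H: "add_subgroup H" "H \<subseteq> K" "y \<notin> H" and U: "open U" "0 \<in> U" "U \<inter> K \<subseteq> H"
    using separating_subgroup[OF comp K q1'] by blast
  obtain M where M: "add_subgroup M" "H \<subseteq> M" "M \<subseteq> K"
    and M_cover: "\<And>x. nmul q x = 0 \<Longrightarrow> \<exists>j<q. x - nmul j y \<in> M"
    and M_unique: "\<And>i j. i < q \<Longrightarrow> j < q \<Longrightarrow> nmul i y - nmul j y \<in> M \<Longrightarrow> i = j"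
    using torsion_index_subgroup[OF q(1) H(1) H(2)[unfolded K_def] y H(3)] unfolding K_def by blast
  note Md = add_subgroupD[OF M(1)] and Kd = add_subgroupD[OF K(2)]
  have UM: "u \<in> M" if "u \<in> U" "u \<in> K" for u using that U(3) M(2) by blast
  have "\<forall>g. \<exists>x :: 'a. nmul q x = g" using compact_connected_divisible[OF comp conn q1'] by blast
  from choice[OF this] obtain s where s: "\<And>g. nmul q (s g :: 'a) = g" by blast
  have "\<forall>x. \<exists>j<q. x - s (nmul q x) - nmul j y \<in> M"
    using M_cover s by (simp add: nmul_diff)
  from choice[OF this] obtain idx where idx: "\<And>x. idx x < q" "\<And>x. x - s (nmul q x) - nmul (idx x) y \<in> M"
    by blast
  define \<theta> where "\<theta> x = (nmul q x, idx x)" for x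
  have nmul_jy: "nmul q (nmul j y) = 0" for j
    using y by (metis mult.commute nmul_mult nmul_simps(3))
  have \<theta>_eq: "\<theta> x = \<theta> x' \<longleftrightarrow> x - x' \<in> M" for x x'
  proof
    assume e: "\<theta> x = \<theta> x'"
    then have "(x - s (nmul q x) - nmul (idx x) y) - (x' - s (nmul q x) - nmul (idx x) y) \<in> M"
      using Md(2)[OF idx(2)[of x] idx(2)[of x']] unfolding \<theta>_def by simp
    then show "x - x' \<in> M" by simp
  next
    assume m: "x - x' \<in> M"
    then have e: "nmul q x = nmul q x'" using M(3) unfolding K_def by (auto simp: nmul_diff)
    have "(x - x') - ((x - s (nmul q x) - nmul (idx x) y) - (x' - s (nmul q x') - nmul (idx x') y)) \<in> M"
      using Md(2)[OF m Md(2)[OF idx(2)[of x] idx(2)[of x']]] .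
    then have "nmul (idx x) y - nmul (idx x') y \<in> M" unfolding e by (simp add: algebra_simps)
    then show "\<theta> x = \<theta> x'" using M_unique idx(1) e unfolding \<theta>_def by simp
  qed
  have \<theta>_onto: "\<exists>x. (g, j) = \<theta> x" if j: "j < q" for g j
  proof
    let ?x = "s g + nmul j y"
    have g: "nmul q ?x = g" by (simp add: nmul_plus s nmul_jy)
    then have "nmul j y - nmul (idx ?x) y \<in> M" using idx(2)[of ?x] by simp
    then have "j = idx ?x" by (rule M_unique[OF j idx(1)])
    then show "(g, j) = \<theta> ?x" unfolding \<theta>_def using g by simp
  qed
  define op where "op B \<longleftrightarrow> B \<subseteq> UNIV \<times> {..<k} \<and> open (\<theta> -` B) \<and> (\<forall>j\<in>{q..<k}. open {g. (g, j) \<in> B})"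
    for B :: "('a \<times> nat) set"
  have "istopology op"
    unfolding istopology_def
  proof (intro conjI allI impI)
    fix B C assume "op B" "op C"
    moreover have "{g. (g, j) \<in> B \<inter> C} = {g. (g, j) \<in> B} \<inter> {g. (g, j) \<in> C}" for j by auto
    ultimately show "op (B \<inter> C)" unfolding op_def by (auto simp: vimage_Int)
  next
    fix \<B> assume "\<forall>B\<in>\<B>. op B"
    moreover have "{g. (g, j) \<in> \<Union>\<B>} = (\<Union>B\<in>\<B>. {g. (g, j) \<in> B})" for j by auto
    moreover have "\<theta> -` \<Union>\<B> = (\<Union>B\<in>\<B>. \<theta> -` B)" by auto
    ultimately show "op (\<Union>\<B>)" unfolding op_def by (auto intro!: open_UN)
  qed
  define X where "X = topology op"
  have opX: "openin X = op" unfolding X_def using \<open>istopology op\<close> by simp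
  have \<theta>_k: "\<theta> x \<in> UNIV \<times> {..<k}" for x using idx(1)[of x] q(2) unfolding \<theta>_def by auto
  have opU: "op (UNIV \<times> {..<k})"
  proof -
    have "\<theta> -` (UNIV \<times> {..<k}) = UNIV" using \<theta>_k by blast
    then show ?thesis unfolding op_def by simp
  qed
  have topX: "topspace X = UNIV \<times> {..<k}"
  proof (rule equalityI)
    show "topspace X \<subseteq> UNIV \<times> {..<k}"
      using openin_topspace[of X, unfolded opX] unfolding op_def by blast
    show "UNIV \<times> {..<k} \<subseteq> topspace X"
      by (rule openin_subset) (simp only: opX opU)
  qed
  have \<theta>_snd: "(g, j) \<noteq> \<theta> x" if "j \<ge> q" for g j x using idx(1)[of x] that unfolding \<theta>_def by auto
  have open_fst: "open (fst ` B)" if B: "openin X B" for B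
  proof -
    have B': "B \<subseteq> UNIV \<times> {..<k}" "open (\<theta> -` B)" "\<And>j. j \<in> {q..<k} \<Longrightarrow> open {g. (g, j) \<in> B}"
      using B unfolding opX op_def by auto
    have "fst ` B = nmul q ` (\<theta> -` B) \<union> (\<Union>j\<in>{q..<k}. {g. (g, j) \<in> B})"
    proof (intro equalityI subsetI)
      fix g assume "g \<in> fst ` B"
      then obtain j where j: "(g, j) \<in> B" by auto
      then have "j < k" using B'(1) by auto
      show "g \<in> nmul q ` (\<theta> -` B) \<union> (\<Union>j\<in>{q..<k}. {g. (g, j) \<in> B})"
      proof (cases "j < q")
        case True
        then obtain x where x: "(g, j) = \<theta> x" using \<theta>_onto by blast
        then have "g = nmul q x" "x \<in> \<theta> -` B" using j unfolding \<theta>_def by auto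
        then show ?thesis by blast
      next
        case False
        then show ?thesis using j \<open>j < k\<close> by auto
      qed
    next
      fix g assume "g \<in> nmul q ` (\<theta> -` B) \<union> (\<Union>j\<in>{q..<k}. {g. (g, j) \<in> B})"
      then show "g \<in> fst ` B" unfolding \<theta>_def by force
    qed
    moreover have "open (nmul q ` (\<theta> -` B))" by (rule open_map_nmul[OF comp conn q1' B'(2)])
    ultimately show ?thesis using B'(3) by (auto intro!: open_Un open_UN)
  qed
  have cont_fst: "continuous_map X euclidean fst"
  proof -
    have "openin X {x \<in> topspace X. fst x \<in> P}" if P: "open P" for P :: "'a set"
    proof -
      have "\<theta> -` {x \<in> topspace X. fst x \<in> P} = nmul q -` P"
        using \<theta>_k unfolding topX \<theta>_def by auto
      moreover have "open (nmul q -` P)" using P by (rule open_vimage) (auto intro: continuous_intros)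
      moreover have "{g. (g, j) \<in> {x \<in> topspace X. fst x \<in> P}} = P" if "j \<in> {q..<k}" for j
        using that unfolding topX by auto
      ultimately show ?thesis using P unfolding opX op_def topX by auto
    qed
    then show ?thesis unfolding continuous_map by auto
  qed
  obtain N where N: "sym_nbhd N" "\<And>a b. a \<in> N \<Longrightarrow> b \<in> N \<Longrightarrow> a + b \<in> U"
    using halve_nbhd[OF U(1,2)] by blast
  have N_diff: "a - b \<in> U" if "a \<in> N" "b \<in> N" for a b
    using N(2)[of a "- b"] N(1) that unfolding sym_nbhd_def by simp
  have N0: "0 \<in> N" and No: "open N" using N(1) unfolding sym_nbhd_def by auto
  have even: "\<exists>W. openin euclidean W \<and> g \<in> W \<and> (\<exists>V. {x \<in> topspace X. fst x \<in> W} = (\<Union>i\<in>{1..k}. V i) \<and>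
        disjoint_family_on V {1..k} \<and> (\<forall>i\<in>{1..k}. openin X (V i) \<and>
              homeomorphic_map (subtopology X (V i)) (subtopology euclidean W) fst))" for g :: 'a
  proof -
    \<comment> \<open>\<open>N\<close> is so small that two points of a translate of \<open>N\<close> that differ by an element of \<open>K\<close> differ by an
      element of \<open>M\<close>. So \<open>\<theta>\<close> maps the translates \<open>B j\<close> onto disjoint sheets over the same set \<open>W\<close>.\<close>
    define B where "B j = {x. x - (s g + nmul j y) \<in> N}" for j
    define W where "W = nmul q ` {x. x - s g \<in> N}"
    define V where "V i = (if i - 1 < q then \<theta> ` B (i - 1) else W \<times> {i - 1})" for i :: nat
    have oW: "open W" unfolding W_def by (rule open_map_nmul[OF comp conn q1' open_translate(1)[OF No]])
    have gW: "g \<in> W"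
      unfolding W_def using s[of g] N0 by (intro image_eqI[of _ _ "s g"]) simp_all
    have nmul_B: "nmul q ` B j = W" for j
    proof (intro equalityI subsetI)
      fix w assume "w \<in> nmul q ` B j"
      then obtain x where x: "w = nmul q x" "x \<in> B j" by blast
      then have "w = nmul q (x - nmul j y)" "x - nmul j y - s g \<in> N"
        unfolding B_def by (simp_all add: nmul_diff nmul_jy algebra_simps)
      then show "w \<in> W" unfolding W_def by blast
    next
      fix w assume "w \<in> W"
      then obtain x where x: "w = nmul q x" "x - s g \<in> N" unfolding W_def by blast
      then have "w = nmul q (x + nmul j y)" "x + nmul j y \<in> B j"
        unfolding B_def by (simp_all add: nmul_plus nmul_jy algebra_simps)
      then show "w \<in> nmul q ` B j" by blast
    qed
    have fst_\<theta>: "fst (\<theta> x) = nmul q x" for x unfolding \<theta>_def by simp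
    have V_fst: "fst ` V i = W" for i
      unfolding V_def using nmul_B[of "i - 1"] by (auto simp: image_image fst_\<theta>)
    have B_inj: "\<theta> x = \<theta> x'" if "x \<in> B j" "x' \<in> B j" "nmul q x = nmul q x'" for x x' j
    proof -
      have "(x - (s g + nmul j y)) - (x' - (s g + nmul j y)) \<in> U"
        using that(1,2) unfolding B_def by (intro N_diff) auto
      then have "x - x' \<in> U" by simp
      moreover have "x - x' \<in> K" using that(3) unfolding K_def by (simp add: nmul_diff)
      ultimately show ?thesis using UM \<theta>_eq by blast
    qed
    have V_inj: "inj_on fst (V i)" for i
    proof (cases "i - 1 < q")
      case True
      show ?thesis
      proof (rule inj_onI)
        fix v v' assume v: "v \<in> V i" "v' \<in> V i" "fst v = fst v'"
        then obtain x x' where "x \<in> B (i - 1)" "v = \<theta> x" "x' \<in> B (i - 1)" "v' = \<theta> x'"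
          using True unfolding V_def by auto
        then show "v = v'" using B_inj[of x "i - 1" x'] v(3) by (simp add: fst_\<theta>)
      qed
    qed (auto simp: V_def inj_on_def)
    have V_open: "openin X (V i)" if i: "i \<in> {1..k}" for i
    proof (cases "i - 1 < q")
      case True
      have "\<theta> -` (\<theta> ` B (i - 1)) = (\<Union>m\<in>M. {x. x - m \<in> B (i - 1)})"
      proof (intro equalityI subsetI)
        fix x assume "x \<in> \<theta> -` (\<theta> ` B (i - 1))"
        then obtain x' where x': "x' \<in> B (i - 1)" "\<theta> x = \<theta> x'" by auto
        then have "x - x' \<in> M" "x - (x - x') \<in> B (i - 1)" using \<theta>_eq by auto
        then show "x \<in> (\<Union>m\<in>M. {x. x - m \<in> B (i - 1)})" by blast
      next
        fix x assume "x \<in> (\<Union>m\<in>M. {x. x - m \<in> B (i - 1)})"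
        then obtain m where "m \<in> M" "x - m \<in> B (i - 1)" by blast
        then have "\<theta> x = \<theta> (x - m)" using \<theta>_eq[of x "x - m"] by simp
        then show "x \<in> \<theta> -` (\<theta> ` B (i - 1))" using \<open>x - m \<in> B (i - 1)\<close> by blast
      qed
      moreover have "open (B (i - 1))" unfolding B_def by (rule open_translate(1)[OF No])
      ultimately have "open (\<theta> -` (\<theta> ` B (i - 1)))" using open_translate(1) by (auto intro!: open_UN)
      moreover have "{g. (g, j) \<in> \<theta> ` B (i - 1)} = {}" if "j \<in> {q..<k}" for j
        using \<theta>_snd that by fastforce
      moreover have "\<theta> ` B (i - 1) \<subseteq> UNIV \<times> {..<k}" using \<theta>_k by (rule image_subsetI)
      ultimately have "op (\<theta> ` B (i - 1))" unfolding op_def by simp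
      then show ?thesis using True unfolding opX V_def by simp
    next
      case False
      have "\<theta> -` (W \<times> {i - 1}) = {}" using idx(1) False by (auto simp: \<theta>_def) (metis One_nat_def)
      moreover have "open {g. (g, j) \<in> W \<times> {i - 1}}" for j using oW by (cases "j = i - 1") auto
      moreover have "i - 1 < k" using i by auto
      ultimately have "op (W \<times> {i - 1})" unfolding op_def by auto
      then show ?thesis using False unfolding opX V_def by simp
    qed
    have homeo: "homeomorphic_map (subtopology X (V i)) (subtopology euclidean W) fst" if i: "i \<in> {1..k}" for i
    proof (rule bijective_open_imp_homeomorphic_map)
      have VX: "V i \<subseteq> topspace X" using openin_subset[OF V_open[OF i]] .
      then have top: "topspace (subtopology X (V i)) = V i" by auto
      show "continuous_map (subtopology X (V i)) (subtopology euclidean W) fst"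
        using continuous_map_from_subtopology[OF cont_fst] V_fst VX
        by (auto simp: continuous_map_in_subtopology)
      show "open_map (subtopology X (V i)) (subtopology euclidean W) fst"
        unfolding open_map_def
      proof (intro allI impI)
        fix O' assume "openin (subtopology X (V i)) O'"
        then have "openin X O'" "O' \<subseteq> V i" using V_open[OF i] by (simp_all add: openin_open_subtopology)
        then have "open (fst ` O')" "fst ` O' \<subseteq> fst ` V i" using open_fst by blast+
        then show "openin (subtopology euclidean W) (fst ` O')" using oW V_fst[of i] by (simp add: openin_open_eq)
      qed
      show "fst ` topspace (subtopology X (V i)) = topspace (subtopology euclidean W)"
        using V_fst top by simp
      show "inj_on fst (topspace (subtopology X (V i)))" using V_inj top by simp
    qed
    have V_disj: "i = i'" if i: "i \<in> {1..k}" "i' \<in> {1..k}" and z: "z \<in> V i" "z \<in> V i'" for i i' z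
    proof -
      let ?j = "i - 1" and ?j' = "i' - 1"
      have "?j = ?j'"
      proof (cases "?j < q")
        case True
        then obtain x where x: "z = \<theta> x" "x \<in> B ?j" using z(1) unfolding V_def by auto
        then have "snd z < q" using idx(1) unfolding \<theta>_def by simp
        then have j': "?j' < q" using z(2) unfolding V_def by (cases "?j' < q") auto
        then obtain x' where x': "z = \<theta> x'" "x' \<in> B ?j'" using z(2) unfolding V_def by auto
        have m: "x - x' \<in> M" using x(1) x'(1) \<theta>_eq[of x x'] by argo
        let ?u = "(x - (s g + nmul ?j y)) - (x' - (s g + nmul ?j' y))"
        have "?u \<in> U" using x(2) x'(2) unfolding B_def by (intro N_diff) auto
        moreover have "?u = (x - x') - (nmul ?j y - nmul ?j' y)" by (simp add: algebra_simps)
        moreover have "(x - x') - (nmul ?j y - nmul ?j' y) \<in> K"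
        proof -
          have "x - x' \<in> K" using m M(3) by blast
          then show ?thesis unfolding K_def by (simp add: nmul_diff nmul_jy)
        qed
        ultimately have "(x - x') - (nmul ?j y - nmul ?j' y) \<in> M" by (metis UM)
        then have "(x - x') - ((x - x') - (nmul ?j y - nmul ?j' y)) \<in> M" by (rule Md(2)[OF m])
        then have "nmul ?j y - nmul ?j' y \<in> M" by simp
        then show ?thesis by (rule M_unique[OF True j'])
      next
        case False
        then have z1: "snd z = ?j" using z(1) unfolding V_def by auto
        show ?thesis
        proof (cases "?j' < q")
          case True
          then have "snd z < q" using z(2) idx(1) unfolding V_def \<theta>_def by auto
          then show ?thesis using z1 False by simp
        next
          case False
          then show ?thesis using z(2) z1 unfolding V_def by auto
        qed
      qed
      then show ?thesis using i by auto
    qed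
    have union: "{x \<in> topspace X. fst x \<in> W} = (\<Union>i\<in>{1..k}. V i)"
    proof (intro equalityI subsetI)
      fix z assume "z \<in> (\<Union>i\<in>{1..k}. V i)"
      then obtain i where i: "i \<in> {1..k}" "z \<in> V i" by blast
      then have "z \<in> topspace X" using openin_subset[OF V_open[OF i(1)]] by blast
      moreover have "fst z \<in> W" using V_fst[of i] i(2) by blast
      ultimately show "z \<in> {x \<in> topspace X. fst x \<in> W}" by simp
    next
      fix z assume z: "z \<in> {x \<in> topspace X. fst x \<in> W}"
      obtain w j where wj: "z = (w, j)" by (cases z)
      have w: "w \<in> W" "j < k" using z wj unfolding topX by auto
      show "z \<in> (\<Union>i\<in>{1..k}. V i)"
      proof (cases "j < q")
        case False
        then have "z \<in> V (Suc j)" using w wj unfolding V_def by simp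
        then show ?thesis using w(2) by force
      next
        case True
        then obtain x where x: "z = \<theta> x" using \<theta>_onto wj by blast
        obtain x0 where x0: "w = nmul q x0" "x0 - s g \<in> N" using w(1) unfolding W_def by blast
        have "nmul q (x - x0) = 0" using x wj x0(1) unfolding \<theta>_def by (simp add: nmul_diff)
        then obtain j' where j': "j' < q" "x - x0 - nmul j' y \<in> M" using M_cover by blast
        have "x0 + nmul j' y \<in> B j'" using x0(2) unfolding B_def by (simp add: algebra_simps)
        moreover have "x - (x0 + nmul j' y) \<in> M" using j'(2) by (simp add: algebra_simps)
        then have "z = \<theta> (x0 + nmul j' y)" using x \<theta>_eq by blast
        ultimately have "z \<in> V (Suc j')" using j'(1) unfolding V_def by auto
        then show ?thesis using j'(1) q(2) by force
      qed
    qed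
    have "disjoint_family_on V {1..k}" unfolding disjoint_family_on_def using V_disj by blast
    moreover have "openin euclidean W" using oW by simp
    ultimately show ?thesis
      using gW union V_open homeo by (intro exI[of _ W] exI[of _ V] conjI ballI)
  qed
  have k: "0 < k" using q1 q(2) by simp
  have cov: "fold_covering_map k X euclidean fst"
    unfolding fold_covering_map_def topspace_euclidean
  proof (intro conjI ballI)
    show "continuous_map X euclidean fst" by (rule cont_fst)
    show "fst ` topspace X = UNIV" unfolding topX using k by (auto simp: image_iff)
  qed (rule even)
  then have "trivial_fold_covering k X euclidean fst"
    using triv fold_covering_Hausdorff[OF cov] unfolding all_fold_coverings_trivial_def by blast
  then obtain \<rho> where \<rho>: "homeomorphic_map (prod_topology euclidean (discrete_topology {1..k})) X \<rho>"
    and p\<rho>: "\<And>g n. n \<in> {1..k} \<Longrightarrow> fst (\<rho> (g, n)) = g"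
    unfolding trivial_fold_covering_def by auto
  let ?P = "prod_topology (euclidean :: 'a topology) (discrete_topology {1..k})"
  have img: "\<rho> ` (UNIV \<times> {1..k}) = topspace X"
    using homeomorphic_imp_surjective_map[OF \<rho>] by simp
  have inj: "inj_on \<rho> (UNIV \<times> {1..k})"
    using homeomorphic_imp_injective_map[OF \<rho>] by simp
  have sheet_open: "open (\<theta> -` (\<rho> ` (UNIV \<times> J)))" if "J \<subseteq> {1..k}" for J
  proof -
    have "openin ?P (UNIV \<times> J)" using that by (simp add: openin_prod_Times_iff)
    then have "openin X (\<rho> ` (UNIV \<times> J))"
      using homeomorphic_imp_open_map[OF \<rho>] unfolding open_map_def by blast
    then show ?thesis unfolding opX op_def by blast
  qed
  have "\<theta> 0 \<in> \<rho> ` (UNIV \<times> {1..k})" using \<theta>_k[of 0] unfolding img topX .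
  then obtain g0 n where n: "n \<in> {1..k}" "\<theta> 0 = \<rho> (g0, n)" by auto
  let ?C = "\<theta> -` (\<rho> ` (UNIV \<times> {n}))" and ?C' = "\<theta> -` (\<rho> ` (UNIV \<times> ({1..k} - {n})))"
  have "UNIV \<subseteq> ?C \<union> ?C'"
  proof
    fix x
    have "\<theta> x \<in> \<rho> ` (UNIV \<times> {1..k})" using \<theta>_k[of x] unfolding img topX .
    then show "x \<in> ?C \<union> ?C'" by auto
  qed
  moreover have "?C \<inter> ?C' \<inter> UNIV = {}"
  proof -
    have "\<rho> ` (UNIV \<times> {n}) \<inter> \<rho> ` (UNIV \<times> ({1..k} - {n})) = {}"
      using n(1) by (subst inj_on_image_Int[OF inj, symmetric]) auto
    then show ?thesis by blast
  qed
  moreover have "0 \<in> ?C" using n(2) by auto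
  moreover have "open ?C" "open ?C'" using sheet_open n(1) by auto
  ultimately have "y \<in> ?C"
    using connectedD[OF conn, of ?C ?C'] by blast
  then have "\<theta> y \<in> \<rho> ` (UNIV \<times> {n})" by (simp only: vimage_eq)
  then obtain g where g: "\<theta> y = \<rho> (g, n)" by (elim imageE SigmaE singletonE) simp
  have "g = 0" "g0 = 0" using p\<rho>[OF n(1), of g] p\<rho>[OF n(1), of g0] g n(2) y unfolding \<theta>_def
    by (metis fst_conv, metis fst_conv nmul_simps(3))
  then have "\<theta> y = \<theta> 0" using g n(2) by simp
  then have "y - 0 \<in> M" using \<theta>_eq by blast
  then have "nmul 1 y - nmul 0 y \<in> M" by simp
  then show False using M_unique[of 1 0] q1 by simp
qed

section \<open>Trivial coverings and means\<close>

lemma sum_constant_nmul: "finite A \<Longrightarrow> (\<Sum>i\<in>A. y) = nmul (card A) y"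
  by (induction A rule: finite_induct) (simp_all add: add.commute)

lemma continuous_map_sum_comm_monoid:
  fixes f :: "'i \<Rightarrow> 'b \<Rightarrow> 'c::topological_comm_monoid_add"
  assumes "\<And>i. i \<in> I \<Longrightarrow> continuous_map X euclidean (f i)"
  shows "continuous_map X euclidean (\<lambda>x. \<Sum>i\<in>I. f i x)"
  using assms by (simp add: continuous_map_atin tendsto_sum)

text \<open>
  Multiplication by every \<open>j \<le> k\<close> is injective by a prime factorisation of \<open>j\<close>, hence so is
  multiplication by \<open>k!\<close>, and the mean divides a sum of \<open>k!\<close> terms by \<open>k!\<close>.
\<close>

theorem coverings_trivial_imp_mean:
  assumes comp: "compact (UNIV :: 'a::{topological_ab_group_add, t2_space} set)"
    and conn: "connected (UNIV :: 'a set)"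
    and triv: "all_fold_coverings_trivial TYPE('a \<times> nat) k (euclidean :: 'a topology)"
  shows "admits_mean (fact k) (euclidean :: 'a topology)"
proof -
  define m :: nat where "m = fact k"
  have ker: "x = 0" if "nmul j x = 0" "1 \<le> j" "j \<le> k" for j and x :: 'a
    using that
  proof (induction j arbitrary: x rule: less_induct)
    case (less j)
    show ?case
    proof (cases "j = 1")
      case True
      then show ?thesis using less.prems(1) by simp
    next
      case False
      then obtain q where q: "prime q" "q dvd j" using prime_factor_nat by blast
      then obtain r where r: "j = q * r" by blast
      have r0: "r > 0" and j0: "0 < j" using r less.prems(2) by auto
      have "nmul q (nmul r x) = 0" using less.prems(1) unfolding r nmul_mult .
      moreover have "q \<le> k" using q(2) dvd_imp_le[OF q(2) j0] less.prems(3) by simp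
      ultimately have z: "nmul r x = 0"
        using coverings_trivial_imp_torsion_free[OF comp conn triv q(1)] by blast
      have "r < j" using r r0 prime_gt_1_nat[OF q(1)] by simp
      then show ?thesis using less.IH[OF _ z] r0 less.prems(3) by simp
    qed
  qed
  have kerm: "x = 0" if "nmul (fact i) x = 0" "i \<le> k" for i and x :: 'a
    using that
  proof (induction i arbitrary: x)
    case (Suc i)
    have "nmul (Suc i) (nmul (fact i) x) = 0" using Suc.prems(1) by (simp only: fact_Suc of_nat_id nmul_mult)
    then have "nmul (fact i) x = 0" by (rule ker) (use Suc.prems(2) in auto)
    then show ?case by (rule Suc.IH) (use Suc.prems(2) in auto)
  qed simp
  have inj: "inj (nmul m :: 'a \<Rightarrow> 'a)"
  proof (rule injI)
    fix x x' :: 'a assume "nmul m x = nmul m x'"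
    then have "nmul m (x - x') = 0" by (simp add: nmul_diff)
    then show "x = x'" using kerm[of k "x - x'"] unfolding m_def by simp
  qed
  have m1: "m \<ge> 1" unfolding m_def by simp
  have range: "range (nmul m :: 'a \<Rightarrow> 'a) = UNIV"
    using compact_connected_divisible[OF comp conn m1] by (metis surj_def)
  define dv where "dv = inv (nmul m :: 'a \<Rightarrow> 'a)"
  have dv: "dv (nmul m x) = x" for x using inj unfolding dv_def by simp
  have "continuous_on (range (nmul m :: 'a \<Rightarrow> 'a)) dv"
    by (rule continuous_on_inv[OF _ comp]) (auto intro: continuous_intros simp: dv)
  then have dvc: "continuous_map euclidean euclidean dv" unfolding range by simp
  let ?\<mu> = "\<lambda>g :: nat \<Rightarrow> 'a. dv (\<Sum>i\<in>{1..m}. g i)"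
  have sumc: "continuous_map (product_topology (\<lambda>_. euclidean) {1..m}) euclidean (\<lambda>g. \<Sum>i\<in>{1..m}. g i :: 'a)"
    by (rule continuous_map_sum_comm_monoid)
      (use continuous_map_product_projection[of _ "{1..m}" "\<lambda>_. euclidean :: 'a topology"] in simp)
  have "is_mean m euclidean ?\<mu>"
    unfolding is_mean_def
  proof (intro conjI allI impI ballI)
    have "continuous_map (product_topology (\<lambda>_. euclidean) {1..m}) euclidean (dv \<circ> (\<lambda>g. \<Sum>i\<in>{1..m}. g i))"
      using sumc dvc continuous_map_compose by blast
    then show "continuous_map (product_topology (\<lambda>_. euclidean) {1..m}) euclidean ?\<mu>" by (simp add: o_def)
  next
    fix \<pi> and g :: "nat \<Rightarrow> 'a" assume "\<pi> permutes {1..m}"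
    then have "(\<Sum>i\<in>{1..m}. g i) = (\<Sum>i\<in>{1..m}. (g \<circ> \<pi>) i)" by (metis sum.permute)
    then show "?\<mu> (g \<circ> \<pi>) = ?\<mu> g" by simp
  next
    fix y :: 'a
    have "(\<Sum>i\<in>{1..m}. (\<lambda>i\<in>{1..m}. y) i) = nmul m y"
      using sum_constant_nmul[of "{1..m}" y] by simp
    then show "?\<mu> (\<lambda>i\<in>{1..m}. y) = y" using dv by simp
  qed
  then show ?thesis unfolding m_def admits_mean_def by blast
qed

theorem theorem4:
  fixes G :: "'a :: {topological_ab_group_add, t2_space} topology" and k :: nat
  assumes "G = euclidean"
    and "compact (UNIV :: 'a set)" and "connected (UNIV :: 'a set)"
    and "k \<ge> 1"
  shows "(all_fold_coverings_trivial TYPE('a \<times> nat) k G \<longleftrightarrow> admits_mean (fact k) G) \<and>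
         (admits_mean (fact k) G \<longrightarrow> all_fold_coverings_trivial TYPE('b) k G)"
  using coverings_trivial_imp_mean[OF assms(2,3), of k]
    mean_imp_all_fold_coverings_trivial[OF assms(2,3), of k, where 'b = "'a \<times> nat"]
    mean_imp_all_fold_coverings_trivial[OF assms(2,3), of k, where 'b = 'b]
  unfolding assms(1) by (intro conjI iffI impI)

end
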